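(* Suppose $\hat p_{u,i}$ and $\hat e_{u,i}$ are accurate estimates of $p_{u,i}$ and $g_{u,i}$, respectively, i.e. $\hat p_{u,i}=p_{u,i}$ and $\hat e_{u,i}=g_{u,i}$ for all $(u,i)\in\mathcal D$. Then the estimators $\mathcal L_{IPS}$, $\mathcal L_{EIB}$ and $\mathcal L_{DR}$ are unbiased, and their variances satisfy $$\mathrm{Var}(\mathcal L_{EIB})\le \mathrm{Var}(\mathcal L_{DR})\le \mathrm{Var}(\mathcal L_{IPS}),$$ where the equality holds if and only if $p_{u,i}=1$ for all $(u,i)\in\mathcal D$. In addition, when $p_{u,i}$ tends to $0$ (the propensity function tends to $0$, with the joint law of $(x_{u,i},e_{u,i})$ held fixed), $\mathrm{Var}(\mathcal L_{IPS})$ and $\mathrm{Var}(\mathcal L_{DR})$ tend to infinity, and $\mathrm{Var}(\mathcal L_{EIB})$ tends to its minimum (over propensity functions).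
   Context: Setting. $\mathcal U$ and $\mathcal I$ are finite sets of users and items, and $\mathcal D=\mathcal U\times\mathcal I$. For each pair $(u,i)\in\mathcal D$ there are random variables: a feature $x_{u,i}$, an exposure indicator $o_{u,i}\in\{0,1\}$, a feedback $r_{u,i}$, and a potential outcome $r_{u,i}(1)$ (the feedback had $o_{u,i}$ been set to $1$), observed only when $o_{u,i}=1$. $\mathbb P$ is the target distribution and $\mathbb E$, $\mathrm{Var}$ are taken with respect to it. The tuples for different pairs $(u,i)$ are treated as independent and identically distributed. Standing assumptions: unconfoundedness, $r_{u,i}(1)$ is independent of $o_{u,i}$ conditionally on $x_{u,i}$; and consistency, $r_{u,i}(1)=r_{u,i}$ if $o_{u,i}=1$. Let $f_\theta(x_{u,i})$ be a prediction of $r_{u,i}(1)$ for a fixed $\theta$, and let $e_{u,i}$ be the prediction error, a function of $r_{u,i}(1)$ and $f_\theta(x_{u,i})$ (e.g. $e_{u,i}=(r_{u,i}(1)-f_\theta(x_{u,i}))^2$). The propensity is $p_{u,i}=\mathbb P(o_{u,i}=1\mid x_{u,i})$ and $g_{u,i}=\mathbb E[e_{u,i}\mid x_{u,i}]$; both are functions of $x_{u,i}$. The quantities $\hat p_{u,i}$ (learned propensity, in $(0,1]$) and $\hat e_{u,i}$ (imputed error) are estimates of $p_{u,i}$ and $g_{u,i}$, respectively. The ideal loss is $\mathcal L_{ideal}=|\mathcal D|^{-1}\sum_{(u,i)\in\mathcal D}e_{u,i}$. The estimators are $$\mathcal L_{IPS}=|\mathcal D|^{-1}\sum_{(u,i)\in\mathcal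 D}\frac{o_{u,i}e_{u,i}}{\hat p_{u,i}},\qquad \mathcal L_{EIB}=|\mathcal D|^{-1}\sum_{(u,i)\in\mathcal D}\big[o_{u,i}e_{u,i}+(1-o_{u,i})\hat e_{u,i}\big],$$ $$\mathcal L_{DR}=|\mathcal D|^{-1}\sum_{(u,i)\in\mathcal D}\Big[\hat e_{u,i}+\frac{o_{u,i}(e_{u,i}-\hat e_{u,i})}{\hat p_{u,i}}\Big].$$ An estimator $\mathcal L$ is unbiased if $\mathbb E[\mathcal L]=\mathbb E[\mathcal L_{ideal}]=\mathbb E[e_{u,i}]$.
   Formalization: Variances are assumed finite; "only if p=1" is claimed for EIB=DR if Var(e|x)>0, for DR=IPS if g≠0, for both together if E[e²|x]>0 (a.s.); Var(IPS)→∞ needs e not a.s. 0 and Var(DR)→∞ needs Var(e|x) not a.s. 0; e≡1, p=1/2 refutes the literal claim. *)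

theory Defs
  imports "HOL-Probability.Probability"
begin

text \<open>
  A pair \<open>(u, i)\<close> is an element \<open>d\<close> of a finite set \<open>D\<close>. A model bundles the target
  distribution \<open>pspace\<close> with the random variables attached to every pair:
  the feature \<open>x\<close> (\<open>feat\<close>), the exposure \<open>o\<close> (\<open>obs\<close>), the feedback \<open>r\<close> (\<open>fb\<close>), the potential
  outcome \<open>r(1)\<close> (\<open>pot\<close>), the learned propensity (\<open>prop_hat\<close>) and the imputed error (\<open>err_hat\<close>).
\<close>

record ('a, 'x, 'd) rec_model =
  pspace :: "'a measure"
  feat :: "'d \<Rightarrow> 'a \<Rightarrow> 'x"
  obs :: "'d \<Rightarrow> 'a \<Rightarrow> bool"
  fb :: "'d \<Rightarrow> 'a \<Rightarrow> real"
  pot :: "'d \<Rightarrow> 'a \<Rightarrow> real"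
  prop_hat :: "'d \<Rightarrow> 'a \<Rightarrow> real"
  err_hat :: "'d \<Rightarrow> 'a \<Rightarrow> real"

text \<open>Below, \<open>f\<close> is the prediction function \<open>f\<^sub>\<theta>\<close> for the fixed \<open>\<theta>\<close>, and \<open>l y z\<close> is the error of
  the prediction \<open>z\<close> when the potential outcome is \<open>y\<close>, for instance \<open>(y - z)\<^sup>2\<close>.\<close>

definition err :: "('x \<Rightarrow> real) \<Rightarrow> (real \<Rightarrow> real \<Rightarrow> real) \<Rightarrow> ('a, 'x, 'd) rec_model
    \<Rightarrow> 'd \<Rightarrow> 'a \<Rightarrow> real" where
  "err f l m d \<omega> = l (pot m d \<omega>) (f (feat m d \<omega>))"


subsection \<open>Conditioning on the feature\<close>

definition feat_algebra :: "'x measure \<Rightarrow> ('a, 'x, 'd) rec_model \<Rightarrow> 'd \<Rightarrow> 'a measure" where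
  "feat_algebra X m d = vimage_algebra (space (pspace m)) (feat m d) X"

definition cond_exp_feat :: "'x measure \<Rightarrow> ('a, 'x, 'd) rec_model \<Rightarrow> 'd \<Rightarrow> ('a \<Rightarrow> real)
    \<Rightarrow> 'a \<Rightarrow> real" where
  "cond_exp_feat X m d = real_cond_exp (pspace m) (feat_algebra X m d)"

definition propensity :: "'x measure \<Rightarrow> ('a, 'x, 'd) rec_model \<Rightarrow> 'd \<Rightarrow> 'a \<Rightarrow> real" where
  "propensity X m d = cond_exp_feat X m d (indicator {\<omega> \<in> space (pspace m). obs m d \<omega>})"

text \<open>\<open>q\<close> expresses the propensity of the pair \<open>d\<close> as a function of the feature value.\<close>

definition propensity_function :: "'x measure \<Rightarrow> ('a, 'x, 'd) rec_model \<Rightarrow> 'd \<Rightarrow> ('x \<Rightarrow> real)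
    \<Rightarrow> bool" where
  "propensity_function X m d q \<longleftrightarrow>
     q \<in> borel_measurable X \<and>
     (AE \<omega> in pspace m. propensity X m d \<omega> = q (feat m d \<omega>))"

definition err_mean :: "'x measure \<Rightarrow> ('x \<Rightarrow> real) \<Rightarrow> (real \<Rightarrow> real \<Rightarrow> real)
    \<Rightarrow> ('a, 'x, 'd) rec_model \<Rightarrow> 'd \<Rightarrow> 'a \<Rightarrow> real" where
  "err_mean X f l m d = cond_exp_feat X m d (err f l m d)"

definition err_var :: "'x measure \<Rightarrow> ('x \<Rightarrow> real) \<Rightarrow> (real \<Rightarrow> real \<Rightarrow> real)
    \<Rightarrow> ('a, 'x, 'd) rec_model \<Rightarrow> 'd \<Rightarrow> 'a \<Rightarrow> real" where
  "err_var X f l m d = cond_exp_feat X m d (\<lambda>\<omega>. (err f l m d \<omega> - err_mean X f l m d \<omega>)\<^sup>2)"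

definition cond_indep_feat :: "'x measure \<Rightarrow> ('a, 'x, 'd) rec_model \<Rightarrow> 'd
    \<Rightarrow> 'b measure \<Rightarrow> ('a \<Rightarrow> 'b) \<Rightarrow> 'c measure \<Rightarrow> ('a \<Rightarrow> 'c) \<Rightarrow> bool" where
  "cond_indep_feat X m d N1 Y1 N2 Y2 \<longleftrightarrow>
     (\<forall>A \<in> sets N1. \<forall>B \<in> sets N2. AE \<omega> in pspace m.
        cond_exp_feat X m d (indicator {\<omega> \<in> space (pspace m). Y1 \<omega> \<in> A \<and> Y2 \<omega> \<in> B}) \<omega> =
        cond_exp_feat X m d (indicator {\<omega> \<in> space (pspace m). Y1 \<omega> \<in> A}) \<omega> *
        cond_exp_feat X m d (indicator {\<omega> \<in> space (pspace m). Y2 \<omega> \<in> B}) \<omega>)"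


subsection \<open>The standing assumptions\<close>

definition tuple_space :: "'x measure \<Rightarrow> ('x \<times> bool \<times> real \<times> real) measure" where
  "tuple_space X = X \<Otimes>\<^sub>M count_space UNIV \<Otimes>\<^sub>M borel \<Otimes>\<^sub>M borel"

definition tuple :: "('a, 'x, 'd) rec_model \<Rightarrow> 'd \<Rightarrow> 'a \<Rightarrow> 'x \<times> bool \<times> real \<times> real" where
  "tuple m d \<omega> = (feat m d \<omega>, obs m d \<omega>, fb m d \<omega>, pot m d \<omega>)"

locale rec_setting = prob_space "pspace m"
  for m :: "('a, 'x, 'd) rec_model" +
  fixes D :: "'d set" and X :: "'x measure"
    and f :: "'x \<Rightarrow> real" and l :: "real \<Rightarrow> real \<Rightarrow> real"
  assumes finite_pairs: "finite D" and nonempty_pairs: "D \<noteq> {}"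
    and f_measurable: "f \<in> borel_measurable X"
    and l_measurable: "(\<lambda>(y, z). l y z) \<in> borel_measurable (borel \<Otimes>\<^sub>M borel)"
    and tuple_measurable: "d \<in> D \<Longrightarrow> tuple m d \<in> measurable (pspace m) (tuple_space X)"
    and prop_hat_measurable: "d \<in> D \<Longrightarrow> prop_hat m d \<in> borel_measurable (pspace m)"
    and err_hat_measurable: "d \<in> D \<Longrightarrow> err_hat m d \<in> borel_measurable (pspace m)"
    and prop_hat_range: "d \<in> D \<Longrightarrow> \<omega> \<in> space (pspace m) \<Longrightarrow>
          0 < prop_hat m d \<omega> \<and> prop_hat m d \<omega> \<le> 1"
    and independent: "indep_vars (\<lambda>_. tuple_space X) (tuple m) D"
    and identically_distributed: "d \<in> D \<Longrightarrow> d' \<in> D \<Longrightarrow>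
          distr (pspace m) (tuple_space X) (tuple m d) =
          distr (pspace m) (tuple_space X) (tuple m d')"
    and unconfounded: "d \<in> D \<Longrightarrow>
          cond_indep_feat X m d borel (pot m d) (count_space UNIV) (obs m d)"
    and consistent: "d \<in> D \<Longrightarrow> AE \<omega> in pspace m. obs m d \<omega> \<longrightarrow> pot m d \<omega> = fb m d \<omega>"
    and err_square_integrable: "d \<in> D \<Longrightarrow> integrable (pspace m) (\<lambda>\<omega>. (err f l m d \<omega>)\<^sup>2)"

definition accurate_propensity :: "'d set \<Rightarrow> 'x measure \<Rightarrow> ('a, 'x, 'd) rec_model \<Rightarrow> bool" where
  "accurate_propensity D X m \<longleftrightarrow>
     (\<forall>d\<in>D. AE \<omega> in pspace m. prop_hat m d \<omega> = propensity X m d \<omega>)"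

definition accurate_imputation :: "'d set \<Rightarrow> 'x measure \<Rightarrow> ('x \<Rightarrow> real) \<Rightarrow> (real \<Rightarrow> real \<Rightarrow> real)
    \<Rightarrow> ('a, 'x, 'd) rec_model \<Rightarrow> bool" where
  "accurate_imputation D X f l m \<longleftrightarrow>
     (\<forall>d\<in>D. AE \<omega> in pspace m. err_hat m d \<omega> = err_mean X f l m d \<omega>)"

text \<open>The library variance is 0 for a variable whose variance is infinite. The next condition
  makes the variances of all estimators below meaningful (for the doubly robust one it suffices
  together with accuracy).\<close>

definition ips_square_integrable :: "'d set \<Rightarrow> ('x \<Rightarrow> real) \<Rightarrow> (real \<Rightarrow> real \<Rightarrow> real)
    \<Rightarrow> ('a, 'x, 'd) rec_model \<Rightarrow> bool" where
  "ips_square_integrable D f l m \<longleftrightarrow>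
     (\<forall>d\<in>D. integrable (pspace m)
        (\<lambda>\<omega>. (of_bool (obs m d \<omega>) * err f l m d \<omega> / prop_hat m d \<omega>)\<^sup>2))"


subsection \<open>Loss and estimators\<close>

definition L_ideal :: "'d set \<Rightarrow> ('x \<Rightarrow> real) \<Rightarrow> (real \<Rightarrow> real \<Rightarrow> real)
    \<Rightarrow> ('a, 'x, 'd) rec_model \<Rightarrow> 'a \<Rightarrow> real" where
  "L_ideal D f l m \<omega> = (\<Sum>d\<in>D. err f l m d \<omega>) / real (card D)"

definition L_IPS :: "'d set \<Rightarrow> ('x \<Rightarrow> real) \<Rightarrow> (real \<Rightarrow> real \<Rightarrow> real)
    \<Rightarrow> ('a, 'x, 'd) rec_model \<Rightarrow> 'a \<Rightarrow> real" where
  "L_IPS D f l m \<omega> =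
     (\<Sum>d\<in>D. of_bool (obs m d \<omega>) * err f l m d \<omega> / prop_hat m d \<omega>) / real (card D)"

definition L_EIB :: "'d set \<Rightarrow> ('x \<Rightarrow> real) \<Rightarrow> (real \<Rightarrow> real \<Rightarrow> real)
    \<Rightarrow> ('a, 'x, 'd) rec_model \<Rightarrow> 'a \<Rightarrow> real" where
  "L_EIB D f l m \<omega> =
     (\<Sum>d\<in>D. of_bool (obs m d \<omega>) * err f l m d \<omega>
        + (1 - of_bool (obs m d \<omega>)) * err_hat m d \<omega>) / real (card D)"

definition L_DR :: "'d set \<Rightarrow> ('x \<Rightarrow> real) \<Rightarrow> (real \<Rightarrow> real \<Rightarrow> real)
    \<Rightarrow> ('a, 'x, 'd) rec_model \<Rightarrow> 'a \<Rightarrow> real" where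
  "L_DR D f l m \<omega> =
     (\<Sum>d\<in>D. err_hat m d \<omega>
        + of_bool (obs m d \<omega>) * (err f l m d \<omega> - err_hat m d \<omega>) / prop_hat m d \<omega>)
     / real (card D)"

text \<open>Integrability is part of unbiasedness because the library expectation of a non-integrable
  variable is 0.\<close>

definition unbiased :: "'d set \<Rightarrow> ('x \<Rightarrow> real) \<Rightarrow> (real \<Rightarrow> real \<Rightarrow> real)
    \<Rightarrow> ('a, 'x, 'd) rec_model \<Rightarrow> ('a \<Rightarrow> real) \<Rightarrow> bool" where
  "unbiased D f l m L \<longleftrightarrow>
     integrable (pspace m) L \<and>
     prob_space.expectation (pspace m) L = prob_space.expectation (pspace m) (L_ideal D f l m) \<and>
     (\<forall>d\<in>D. prob_space.expectation (pspace m) L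
              = prob_space.expectation (pspace m) (err f l m d))"

definition Var :: "('a, 'x, 'd) rec_model \<Rightarrow> ('a \<Rightarrow> real) \<Rightarrow> real" where
  "Var m L = prob_space.variance (pspace m) L"


subsection \<open>Varying the propensity with the law of feature and error held fixed\<close>

definition same_feat_err_law :: "'d set \<Rightarrow> 'x measure \<Rightarrow> ('x \<Rightarrow> real) \<Rightarrow> (real \<Rightarrow> real \<Rightarrow> real)
    \<Rightarrow> ('a, 'x, 'd) rec_model \<Rightarrow> ('a, 'x, 'd) rec_model \<Rightarrow> bool" where
  "same_feat_err_law D X f l m m' \<longleftrightarrow>
     (\<forall>d\<in>D.
        distr (pspace m') (X \<Otimes>\<^sub>M borel) (\<lambda>\<omega>. (feat m' d \<omega>, err f l m' d \<omega>)) =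
        distr (pspace m) (X \<Otimes>\<^sub>M borel) (\<lambda>\<omega>. (feat m d \<omega>, err f l m d \<omega>)))"

text \<open>The values of the variance of the EIB estimator, with accurate imputation, over all
  propensities in \<open>[0, 1]\<close>. The learned propensity plays no role in this estimator, so it need
  not be accurate here; this admits propensity 0.\<close>

definition EIB_variances :: "'d set \<Rightarrow> 'x measure \<Rightarrow> ('x \<Rightarrow> real) \<Rightarrow> (real \<Rightarrow> real \<Rightarrow> real)
    \<Rightarrow> ('a, 'x, 'd) rec_model \<Rightarrow> real set" where
  "EIB_variances D X f l m =
     {Var m' (L_EIB D f l m') | m' :: ('a, 'x, 'd) rec_model.
        rec_setting m' D X f l \<and> accurate_imputation D X f l m' \<and>
        same_feat_err_law D X f l m m'}"

end

theory Submission
  imports Defs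
begin

text \<open>
  Write \<open>o\<close>, \<open>e\<close>, \<open>p\<close>, \<open>g\<close> for the exposure, the error, the propensity and the conditional mean of
  the error of one pair. Unconfoundedness says that \<open>E[o \<phi>] = E[p \<phi>]\<close> for every function \<open>\<phi>\<close>
  of the feature and the potential outcome, and \<open>e - g\<close> is orthogonal to functions of the feature.
  Hence the three per-pair terms have mean \<open>E e\<close> and second moments
  \<open>E[g\<^sup>2] + E[p (e - g)\<^sup>2]\<close> for EIB, \<open>E[g\<^sup>2] + E[(e - g)\<^sup>2 / p]\<close> for DR and
  \<open>E[e\<^sup>2 / p] = E[g\<^sup>2 / p] + E[(e - g)\<^sup>2 / p]\<close> for IPS. By independence the variances are sums
  over the pairs, so their differences are sums of the nonnegative terms
  \<open>E[(1 / p - p) (e - g)\<^sup>2]\<close> and \<open>E[(1 / p - 1) g\<^sup>2]\<close>. When \<open>p\<close> tends to 0 under a fixed law of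
  feature and error, truncation and dominated convergence make \<open>E[e\<^sup>2 / p]\<close> and
  \<open>E[(e - g)\<^sup>2 / p]\<close> diverge, while \<open>E[p (e - g)\<^sup>2]\<close> tends to 0, its value in the model in which
  nothing is exposed.
\<close>

section \<open>Square-integrable variables and conditional expectation\<close>

text \<open>Unconfoundedness is given only for events of the potential outcome and of the exposure,
  conditionally on the feature. To use it against arbitrary functions of both feature and potential
  outcome, a second, larger sigma-algebra is brought in: conditioning the exposure on feature and
  potential outcome together still gives the propensity. The limit statements compare models with
  different probability measures that share only the law of feature and error of each pair. All
  variances are therefore moved to one fixed model. This needs the conditional mean of the error as
  an actual function of the feature (Doob-Dynkin), and the same function then serves every model.
  The equality cases rest on exact criteria: a pair adds nothing to the gap between DR and EIB iff
  almost surely \<open>p = 1\<close> or the conditional variance of the error is 0, and nothing to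
  the gap between IPS and DR iff almost surely \<open>p = 1\<close> or \<open>g = 0\<close>. Since
  the Bochner integral of a non-integrable function is 0, the exchange of \<open>o\<close> for
  \<open>p\<close> is first proved for nonnegative integrals, which settles integrability on both
  sides at once.\<close>

lemma square_integrable_mult:
  fixes f g :: "'a \<Rightarrow> real"
  assumes [measurable]: "f \<in> borel_measurable M" "g \<in> borel_measurable M"
    and "integrable M (\<lambda>x. (f x)\<^sup>2)" "integrable M (\<lambda>x. (g x)\<^sup>2)"
  shows "integrable M (\<lambda>x. f x * g x)"
proof (rule Bochner_Integration.integrable_bound)
  show "integrable M (\<lambda>x. (f x)\<^sup>2 + (g x)\<^sup>2)"
    using assms by simp
  have "\<bar>f x * g x\<bar> \<le> (f x)\<^sup>2 + (g x)\<^sup>2" for x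
  proof -
    have "2 * (\<bar>f x\<bar> * \<bar>g x\<bar>) \<le> \<bar>f x\<bar>\<^sup>2 + \<bar>g x\<bar>\<^sup>2"
      using sum_squares_bound[of "\<bar>f x\<bar>" "\<bar>g x\<bar>"] by (simp add: mult.assoc)
    moreover have "0 \<le> \<bar>f x\<bar> * \<bar>g x\<bar>"
      by simp
    ultimately have "\<bar>f x\<bar> * \<bar>g x\<bar> \<le> \<bar>f x\<bar>\<^sup>2 + \<bar>g x\<bar>\<^sup>2"
      by linarith
    then show ?thesis
      by (simp add: abs_mult)
  qed
  then show "AE x in M. norm (f x * g x) \<le> norm ((f x)\<^sup>2 + (g x)\<^sup>2)"
    by simp
qed simp

lemma square_integrable_add:
  fixes f g :: "'a \<Rightarrow> real"
  assumes "f \<in> borel_measurable M" "g \<in> borel_measurable M"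
    and "integrable M (\<lambda>x. (f x)\<^sup>2)" "integrable M (\<lambda>x. (g x)\<^sup>2)"
  shows "integrable M (\<lambda>x. (f x + g x)\<^sup>2)"
  using assms square_integrable_mult[OF assms] by (simp add: power2_sum mult.assoc)

lemma square_integrable_diff:
  fixes f g :: "'a \<Rightarrow> real"
  assumes "f \<in> borel_measurable M" "g \<in> borel_measurable M"
    and "integrable M (\<lambda>x. (f x)\<^sup>2)" "integrable M (\<lambda>x. (g x)\<^sup>2)"
  shows "integrable M (\<lambda>x. (f x - g x)\<^sup>2)"
  using assms square_integrable_mult[OF assms] by (simp add: power2_diff mult.assoc)

section \<open>Conditional expectation as an orthogonal projection\<close>

context finite_measure_subalgebra
begin

text \<open>Conditional Jensen for the square keeps the projection inside the square-integrable
  functions, so that products of it with such functions are integrable.\<close>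

lemma cond_exp_square_integrable:
  assumes [measurable]: "h \<in> borel_measurable M" and h2: "integrable M (\<lambda>x. (h x)\<^sup>2)"
  shows "integrable M (\<lambda>x. (real_cond_exp M F h x)\<^sup>2)"
proof (rule Bochner_Integration.integrable_bound)
  have h: "integrable M h"
    by (rule square_integrable_imp_integrable) (use h2 in auto)
  show "integrable M (real_cond_exp M F (\<lambda>x. (h x)\<^sup>2))"
    by (rule real_cond_exp_int(1)[OF h2])
  have "AE x in M. (real_cond_exp M F h x)\<^sup>2 \<le> real_cond_exp M F (\<lambda>x. (h x)\<^sup>2) x"
    by (rule real_cond_exp_jensens_inequality(2)[where I = UNIV]) (use h h2 convex_power2 in auto)
  then show "AE x in M. norm ((real_cond_exp M F h x)\<^sup>2) \<le> norm (real_cond_exp M F (\<lambda>x. (h x)\<^sup>2) x)"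
    by eventually_elim auto
qed measurable

text \<open>The defining property of conditional expectation, tested with an unbounded
  \<open>k\<close>; square integrability of both factors is what makes the product
  integrable.\<close>

lemma cond_exp_residual_orthogonal:
  assumes [measurable]: "h \<in> borel_measurable M" "k \<in> borel_measurable F"
    and h2: "integrable M (\<lambda>x. (h x)\<^sup>2)" and k2: "integrable M (\<lambda>x. (k x)\<^sup>2)"
  shows "(\<integral>x. k x * (h x - real_cond_exp M F h x) \<partial>M) = 0"
proof -
  have [measurable]: "k \<in> borel_measurable M"
    by (rule measurable_from_subalg[OF subalg]) simp
  have "integrable M (\<lambda>x. k x * h x)"
    by (rule square_integrable_mult) (use h2 k2 in auto)
  then show ?thesis
    using real_cond_exp_intg[of k h] by (simp add: right_diff_distrib)
qed

lemma cond_exp_pythagoras: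
  assumes [measurable]: "h \<in> borel_measurable M" and h2: "integrable M (\<lambda>x. (h x)\<^sup>2)"
  shows "(\<integral>x. (h x)\<^sup>2 \<partial>M) =
    (\<integral>x. (h x - real_cond_exp M F h x)\<^sup>2 \<partial>M) + (\<integral>x. (real_cond_exp M F h x)\<^sup>2 \<partial>M)"
proof -
  let ?g = "real_cond_exp M F h"
  have g2: "integrable M (\<lambda>x. (?g x)\<^sup>2)"
    by (rule cond_exp_square_integrable) (use h2 in auto)
  have [measurable]: "?g \<in> borel_measurable M"
    by simp
  have r2: "integrable M (\<lambda>x. (h x - ?g x)\<^sup>2)"
    by (rule square_integrable_diff) (use h2 g2 in auto)
  have c: "integrable M (\<lambda>x. ?g x * (h x - ?g x))"
    by (rule square_integrable_mult) (use r2 g2 in auto)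
  have "(\<integral>x. (h x)\<^sup>2 \<partial>M) = (\<integral>x. (h x - ?g x)\<^sup>2 + 2 * (?g x * (h x - ?g x)) + (?g x)\<^sup>2 \<partial>M)"
    by (intro Bochner_Integration.integral_cong refl) (simp add: power2_eq_square algebra_simps)
  also have "\<dots> = (\<integral>x. (h x - ?g x)\<^sup>2 \<partial>M) + 2 * (\<integral>x. ?g x * (h x - ?g x) \<partial>M) + (\<integral>x. (?g x)\<^sup>2 \<partial>M)"
    using g2 r2 c by simp
  finally show ?thesis
    using cond_exp_residual_orthogonal[of h ?g] h2 g2 by simp
qed

text \<open>\<open>real_cond_exp\<close> is the difference of the \<open>enn2real\<close> images of
  the conditional expectations of the positive and the negative part. This lemma lets arguments in
  nonnegative integrals, free of integrability conditions, speak about it.\<close>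

lemma nn_cond_exp_eq_real_cond_exp:
  assumes f: "integrable M f" and nonneg: "\<And>x. 0 \<le> f x"
  shows "AE x in M. nn_cond_exp M F (\<lambda>x. ennreal (f x)) x = ennreal (real_cond_exp M F f x)"
proof -
  have [measurable]: "f \<in> borel_measurable M"
    using f by auto
  let ?n = "nn_cond_exp M F (\<lambda>x. ennreal (f x))"
  have "(\<integral>\<^sup>+x. ?n x \<partial>M) = (\<integral>\<^sup>+x. f x \<partial>M)"
    using nn_cond_exp_intg[of "\<lambda>_. 1" "\<lambda>x. ennreal (f x)"] by simp
  also have "\<dots> < \<infinity>"
    using f nonneg by (simp add: integrable_iff_bounded)
  \<comment> \<open>Finiteness matters because \<open>enn2real\<close> sends infinity to 0.\<close>
  finally have "AE x in M. ?n x \<noteq> \<infinity>"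
    by (intro nn_integral_PInf_AE) auto
  moreover have "AE x in M. 0 = nn_cond_exp M F (\<lambda>x. ennreal (- f x)) x"
    using nn_cond_exp_F_meas[of "\<lambda>_. 0"] nonneg by (simp only: ennreal_neg neg_le_0_iff_le) simp
  ultimately show ?thesis
    by eventually_elim (simp add: real_cond_exp_def less_top)
qed

end

section \<open>Moments of a single pair\<close>

text \<open>One pair, abstractly: \<open>F\<close> is generated by the feature, \<open>G\<close> by
  feature and potential outcome, \<open>E\<close> is the event of exposure and \<open>e\<close> the
  error. Assumption \<open>unconf\<close> is the working form of unconfoundedness: knowing the
  potential outcome as well does not change the conditional probability of exposure.\<close>

locale exposure = prob_space +
  fixes F G :: "'a measure" and E :: "'a set" and e :: "'a \<Rightarrow> real"
  assumes MG: "subalgebra M G" and GF: "subalgebra G F"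
    and e_G: "e \<in> borel_measurable G" and e2: "integrable M (\<lambda>x. (e x)\<^sup>2)"
    and E_sets [measurable]: "E \<in> sets M"
    and unconf: "AE x in M. real_cond_exp M G (indicator E) x = real_cond_exp M F (indicator E) x"
begin

lemma MF: "subalgebra M F"
  using MG GF by (auto simp: subalgebra_def)

sublocale G: finite_measure_subalgebra M G
  by standard (rule MG)

sublocale F: finite_measure_subalgebra M F
  by standard (rule MF)

lemma FG: "f \<in> borel_measurable F \<Longrightarrow> f \<in> borel_measurable G"
  by (rule measurable_from_subalg[OF GF])

lemma GM: "f \<in> borel_measurable G \<Longrightarrow> f \<in> borel_measurable M"
  by (rule measurable_from_subalg[OF MG])

definition p :: "'a \<Rightarrow> real" where "p = real_cond_exp M F (indicator E)"
definition g :: "'a \<Rightarrow> real" where "g = real_cond_exp M F e"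
text \<open>The conditional variance of the error given the feature.\<close>

definition s :: "'a \<Rightarrow> real" where "s = real_cond_exp M F (\<lambda>x. (e x - g x)\<^sup>2)"

lemma p_F [measurable]: "p \<in> borel_measurable F" and g_F [measurable]: "g \<in> borel_measurable F"
  and s_F [measurable]: "s \<in> borel_measurable F"
  by (simp_all add: p_def g_def s_def)

lemma p_G [measurable]: "p \<in> borel_measurable G" and g_G [measurable]: "g \<in> borel_measurable G"
  by (rule FG, simp)+

lemma p_M [measurable]: "p \<in> borel_measurable M" and g_M [measurable]: "g \<in> borel_measurable M"
  and s_M [measurable]: "s \<in> borel_measurable M" and e_M [measurable]: "e \<in> borel_measurable M"
  by (rule GM, simp add: FG e_G)+

declare e_G [measurable]

section \<open>Exchanging the exposure for its propensity\<close>

lemma indicator_integrable: "integrable M (indicator E :: 'a \<Rightarrow> real)"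
  by (simp add: integrable_indicator_iff emeasure_eq_measure)

lemma p_range: "AE x in M. 0 \<le> p x \<and> p x \<le> 1"
proof -
  have "AE x in M. 0 \<le> p x" "AE x in M. p x \<le> 1"
    unfolding p_def
    by (rule F.real_cond_exp_ge_c F.real_cond_exp_le_c,
        use indicator_integrable in \<open>auto simp: indicator_def\<close>)+
  then show ?thesis
    by eventually_elim auto
qed

text \<open>Stated with absolute values and nonnegative integrals, so that no integrability of
  \<phi> is required; finiteness of either side then yields integrability on the other.\<close>

lemma nn_integral_swap:
  assumes [measurable]: "\<phi> \<in> borel_measurable G"
  shows "(\<integral>\<^sup>+x. ennreal \<bar>indicator E x * \<phi> x\<bar> \<partial>M) = (\<integral>\<^sup>+x. ennreal \<bar>p x * \<phi> x\<bar> \<partial>M)"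
proof -
  have [measurable]: "\<phi> \<in> borel_measurable M"
    by (rule GM) simp
  have "(\<integral>\<^sup>+x. ennreal \<bar>indicator E x * \<phi> x\<bar> \<partial>M) =
      (\<integral>\<^sup>+x. ennreal \<bar>\<phi> x\<bar> * ennreal (indicator E x) \<partial>M)"
    by (intro nn_integral_cong) (simp add: indicator_def)
  also have "\<dots> = (\<integral>\<^sup>+x. ennreal \<bar>\<phi> x\<bar> * nn_cond_exp M G (\<lambda>x. ennreal (indicator E x)) x \<partial>M)"
    by (rule G.nn_cond_exp_intg[symmetric]) auto
  also have "\<dots> = (\<integral>\<^sup>+x. ennreal \<bar>p x * \<phi> x\<bar> \<partial>M)"
  proof (rule nn_integral_cong_AE)
    show "AE x in M. ennreal \<bar>\<phi> x\<bar> * nn_cond_exp M G (\<lambda>x. ennreal (indicator E x)) x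
        = ennreal \<bar>p x * \<phi> x\<bar>"
      using G.nn_cond_exp_eq_real_cond_exp[OF indicator_integrable indicator_pos_le] unconf p_range
      by eventually_elim (simp add: p_def[symmetric] abs_mult ennreal_mult mult.commute)
  qed
  finally show ?thesis .
qed

lemma integrable_swap:
  assumes [measurable]: "\<phi> \<in> borel_measurable G"
  shows "integrable M (\<lambda>x. indicator E x * \<phi> x) \<longleftrightarrow> integrable M (\<lambda>x. p x * \<phi> x)"
proof -
  have [measurable]: "\<phi> \<in> borel_measurable M"
    by (rule GM) simp
  show ?thesis
    using nn_integral_swap[OF assms] by (simp add: integrable_iff_bounded)
qed

lemma integral_swap:
  assumes [measurable]: "\<phi> \<in> borel_measurable G"
  shows "(\<integral>x. indicator E x * \<phi> x \<partial>M) = (\<integral>x. p x * \<phi> x \<partial>M)"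
proof (cases "integrable M (\<lambda>x. indicator E x * \<phi> x)")
  case True
  have [measurable]: "\<phi> \<in> borel_measurable M"
    by (rule GM) simp
  have "(\<integral>x. indicator E x * \<phi> x \<partial>M) = (\<integral>x. \<phi> x * real_cond_exp M G (indicator E) x \<partial>M)"
    using True by (subst G.real_cond_exp_intg(2)) (auto simp: mult.commute)
  also have "\<dots> = (\<integral>x. p x * \<phi> x \<partial>M)"
    using unconf by (intro integral_cong_AE) (auto simp: p_def)
  finally show ?thesis .
next
  \<comment> \<open>Neither side is integrable here, so both integrals have the default value
    0.\<close>
  case False
  then show ?thesis
    using integrable_swap[OF assms] by (simp add: not_integrable_integral_eq)
qed

section \<open>Integrability and orthogonality of the residual\<close>

lemma e_integrable: "integrable M e"
  by (rule square_integrable_imp_integrable) (use e2 in auto)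

lemma g2: "integrable M (\<lambda>x. (g x)\<^sup>2)"
  unfolding g_def by (rule F.cond_exp_square_integrable) (use e2 in auto)

lemma g_integrable: "integrable M g"
  unfolding g_def by (rule F.real_cond_exp_int(1)[OF e_integrable])

lemma integral_g: "(\<integral>x. g x \<partial>M) = (\<integral>x. e x \<partial>M)"
  unfolding g_def by (rule F.real_cond_exp_int(2)[OF e_integrable])

lemma r2: "integrable M (\<lambda>x. (e x - g x)\<^sup>2)"
  by (rule square_integrable_diff) (use e2 g2 in auto)

lemma residual_orthogonal:
  assumes "k \<in> borel_measurable F" "integrable M (\<lambda>x. (k x)\<^sup>2)"
  shows "(\<integral>x. k x * (e x - g x) \<partial>M) = 0"
  unfolding g_def by (rule F.cond_exp_residual_orthogonal) (use e2 assms in auto)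

lemma integrable_p_mult:
  assumes "integrable M f"
  shows "integrable M (\<lambda>x. p x * f x)"
proof (rule Bochner_Integration.integrable_bound[OF assms])
  show "AE x in M. norm (p x * f x) \<le> norm (f x)"
    using p_range by eventually_elim (simp add: abs_mult mult_left_le_one_le)
qed (use assms in auto)

lemma pg2: "integrable M (\<lambda>x. (p x * g x)\<^sup>2)"
  using integrable_p_mult[OF integrable_p_mult[OF g2]]
  by (simp add: power2_eq_square ac_simps)

lemma s_nonneg: "AE x in M. 0 \<le> s x"
  unfolding s_def by (rule F.real_cond_exp_pos) auto

text \<open>The conditional Pythagorean identity: \<open>g\<close> is \<open>F\<close>-measurable,
  so it leaves the conditional expectation of the cross term, where \<open>e - g\<close> has
  conditional mean 0. Hence a positive conditional second moment of the error means that
  \<open>s\<close> and \<open>g\<close> do not vanish together.\<close>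

lemma second_moment_decomposition: "AE x in M. real_cond_exp M F (\<lambda>x. (e x)\<^sup>2) x = s x + (g x)\<^sup>2"
proof -
  have c: "integrable M (\<lambda>x. g x * (e x - g x))"
    by (rule square_integrable_mult) (use g2 r2 in auto)
  have eq: "(\<lambda>x. (e x)\<^sup>2) = (\<lambda>x. ((e x - g x)\<^sup>2 + 2 * (g x * (e x - g x))) + (g x)\<^sup>2)"
    by (auto simp: power2_eq_square algebra_simps)
  have 1: "AE x in M. real_cond_exp M F (\<lambda>x. ((e x - g x)\<^sup>2 + 2 * (g x * (e x - g x))) + (g x)\<^sup>2) x
      = real_cond_exp M F (\<lambda>x. (e x - g x)\<^sup>2 + 2 * (g x * (e x - g x))) x
        + real_cond_exp M F (\<lambda>x. (g x)\<^sup>2) x"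
    by (rule F.real_cond_exp_add) (use r2 c g2 in auto)
  have 2: "AE x in M. real_cond_exp M F (\<lambda>x. (e x - g x)\<^sup>2 + 2 * (g x * (e x - g x))) x
      = s x + real_cond_exp M F (\<lambda>x. 2 * (g x * (e x - g x))) x"
    unfolding s_def by (rule F.real_cond_exp_add) (use r2 c in auto)
  have 3: "AE x in M. real_cond_exp M F (\<lambda>x. 2 * (g x * (e x - g x))) x
      = 2 * real_cond_exp M F (\<lambda>x. g x * (e x - g x)) x"
    by (rule F.real_cond_exp_cmult) (use c in auto)
  have 4: "AE x in M. real_cond_exp M F (\<lambda>x. g x * (e x - g x)) x
      = g x * real_cond_exp M F (\<lambda>x. e x - g x) x"
    by (rule F.real_cond_exp_mult) (use c in auto)
  have 5: "AE x in M. real_cond_exp M F (\<lambda>x. e x - g x) x = g x - real_cond_exp M F g x"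
    using F.real_cond_exp_diff[OF e_integrable g_integrable] by (simp add: g_def)
  have 6: "AE x in M. real_cond_exp M F g x = g x"
    by (rule F.real_cond_exp_F_meas) (use g_integrable in auto)
  have 7: "AE x in M. real_cond_exp M F (\<lambda>x. (g x)\<^sup>2) x = (g x)\<^sup>2"
    by (rule F.real_cond_exp_F_meas) (use g2 in auto)
  show ?thesis
    unfolding eq using 1 2 3 4 5 6 7 by eventually_elim simp
qed

lemma residual_zero_imp_s_zero:
  assumes "AE x in M. (e x - g x)\<^sup>2 = 0"
  shows "AE x in M. s x = 0"
proof -
  have "AE x in M. s x = real_cond_exp M F (\<lambda>_. 0) x"
    unfolding s_def by (rule F.real_cond_exp_cong) (use assms in auto)
  moreover have "AE x in M. real_cond_exp M F (\<lambda>_. 0) x = 0"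
    by (rule F.real_cond_exp_F_meas) auto
  ultimately show ?thesis
    by eventually_elim simp
qed

section \<open>The terms of the three estimators and their moments\<close>

definition eib :: "'a \<Rightarrow> real" where "eib x = g x + indicator E x * (e x - g x)"
definition ips :: "'a \<Rightarrow> real" where "ips x = indicator E x * (e x / p x)"
text \<open>Both \<open>eib\<close> and \<open>dr\<close> have the shape
  \<open>g + indicator E * (c * (e - g))\<close> with an \<open>F\<close>-measurable weight:
  \<open>c = 1\<close> for \<open>eib\<close>, \<open>c = 1 / p\<close> for \<open>dr\<close>. One
  computation therefore gives both second moments.\<close>

definition dr :: "'a \<Rightarrow> real" where "dr x = g x + indicator E x * ((e x - g x) / p x)"

lemma eib_M [measurable]: "eib \<in> borel_measurable M"
  and ips_M [measurable]: "ips \<in> borel_measurable M"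
  and dr_M [measurable]: "dr \<in> borel_measurable M"
  unfolding eib_def[abs_def] ips_def[abs_def] dr_def[abs_def] by measurable

lemma indicator_square: "(indicator E x * c)\<^sup>2 = indicator E x * (c\<^sup>2 :: real)"
  by (simp add: indicator_def)

text \<open>A cross term of \<open>g\<close> with the exposed residual vanishes, because replacing the exposure by
  \<open>p\<close> leaves an \<open>F\<close>-measurable weight against \<open>e - g\<close>.\<close>

lemma second_moment_exposed_residual:
  assumes c [measurable]: "c \<in> borel_measurable F"
    and pc2: "integrable M (\<lambda>x. (p x * c x * g x)\<^sup>2)"
    and pr2: "integrable M (\<lambda>x. p x * (c x * (e x - g x))\<^sup>2)"
  defines "Y \<equiv> \<lambda>x. g x + indicator E x * (c x * (e x - g x))"
  shows "integrable M (\<lambda>x. (Y x)\<^sup>2)"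
    and "(\<integral>x. (Y x)\<^sup>2 \<partial>M) = (\<integral>x. (g x)\<^sup>2 \<partial>M) + (\<integral>x. p x * (c x * (e x - g x))\<^sup>2 \<partial>M)"
proof -
  have [measurable]: "c \<in> borel_measurable G" "c \<in> borel_measurable M"
    using FG[OF c] GM[OF FG[OF c]] .
  have z2: "integrable M (\<lambda>x. (indicator E x * (c x * (e x - g x)))\<^sup>2)"
    unfolding indicator_square by (subst integrable_swap) (use pr2 in auto)
  show "integrable M (\<lambda>x. (Y x)\<^sup>2)"
    unfolding Y_def by (rule square_integrable_add) (use g2 z2 in auto)
  have cross: "integrable M (\<lambda>x. g x * (indicator E x * (c x * (e x - g x))))"
    by (rule square_integrable_mult) (use g2 z2 in auto)
  have "(\<integral>x. g x * (indicator E x * (c x * (e x - g x))) \<partial>M)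
      = (\<integral>x. indicator E x * (g x * (c x * (e x - g x))) \<partial>M)"
    by (simp add: ac_simps)
  also have "\<dots> = (\<integral>x. (p x * c x * g x) * (e x - g x) \<partial>M)"
    by (subst integral_swap) (auto simp: ac_simps)
  also have "\<dots> = 0"
    by (rule residual_orthogonal) (use pc2 in auto)
  finally have cross0: "(\<integral>x. g x * (indicator E x * (c x * (e x - g x))) \<partial>M) = 0" .
  have "(\<integral>x. (Y x)\<^sup>2 \<partial>M) = (\<integral>x. (g x)\<^sup>2 + (indicator E x * (c x * (e x - g x)))\<^sup>2
      + 2 * (g x * (indicator E x * (c x * (e x - g x)))) \<partial>M)"
    unfolding Y_def by (simp add: power2_sum mult.assoc)
  also have "\<dots> = (\<integral>x. (g x)\<^sup>2 \<partial>M) + (\<integral>x. (indicator E x * (c x * (e x - g x)))\<^sup>2 \<partial>M)"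
    using g2 z2 cross cross0 by simp
  also have "(\<integral>x. (indicator E x * (c x * (e x - g x)))\<^sup>2 \<partial>M)
      = (\<integral>x. p x * (c x * (e x - g x))\<^sup>2 \<partial>M)"
    unfolding indicator_square by (subst integral_swap) auto
  finally show "(\<integral>x. (Y x)\<^sup>2 \<partial>M)
      = (\<integral>x. (g x)\<^sup>2 \<partial>M) + (\<integral>x. p x * (c x * (e x - g x))\<^sup>2 \<partial>M)" .
qed

lemma eib_square_integrable: "integrable M (\<lambda>x. (eib x)\<^sup>2)"
  and eib_second_moment:
    "(\<integral>x. (eib x)\<^sup>2 \<partial>M) = (\<integral>x. (g x)\<^sup>2 \<partial>M) + (\<integral>x. p x * (e x - g x)\<^sup>2 \<partial>M)"
  using second_moment_exposed_residual[of "\<lambda>_. 1"] pg2 integrable_p_mult[OF r2]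
  by (simp_all add: eib_def)

lemma integral_eib: "(\<integral>x. eib x \<partial>M) = (\<integral>x. e x \<partial>M)"
proof -
  have p2: "integrable M (\<lambda>x. (p x)\<^sup>2)"
    using integrable_p_mult[OF integrable_p_mult[of "\<lambda>_. 1"]] by (simp add: power2_eq_square)
  have i: "integrable M (\<lambda>x. indicator E x * (e x - g x))"
    using integrable_mult_indicator[OF E_sets, of "\<lambda>x. e x - g x"] e_integrable g_integrable by simp
  have "(\<integral>x. eib x \<partial>M) = (\<integral>x. g x \<partial>M) + (\<integral>x. indicator E x * (e x - g x) \<partial>M)"
    unfolding eib_def using i g_integrable by simp
  also have "(\<integral>x. indicator E x * (e x - g x) \<partial>M) = (\<integral>x. p x * (e x - g x) \<partial>M)"
    by (rule integral_swap) simp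
  also have "\<dots> = 0"
    by (rule residual_orthogonal) (use p2 in auto)
  finally show ?thesis
    by (simp add: integral_g)
qed

section \<open>Terms with inverse propensity weights\<close>

context
  assumes p_pos: "AE x in M. 0 < p x"
    and ips_sq: "integrable M (\<lambda>x. (ips x)\<^sup>2)"
begin

text \<open>Squaring produces two factors \<open>1 / p\<close>; the exchange of the exposure for
  \<open>p\<close> cancels one of them.\<close>

lemma e2_over_p: "integrable M (\<lambda>x. (e x)\<^sup>2 / p x)"
  and ips_second_moment: "(\<integral>x. (ips x)\<^sup>2 \<partial>M) = (\<integral>x. (e x)\<^sup>2 / p x \<partial>M)"
proof -
  have ae: "AE x in M. p x * (e x / p x)\<^sup>2 = (e x)\<^sup>2 / p x"
    using p_pos by eventually_elim (simp add: power2_eq_square)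
  have "integrable M (\<lambda>x. p x * (e x / p x)\<^sup>2)"
    using ips_sq unfolding ips_def indicator_square by (subst (asm) integrable_swap) auto
  then show "integrable M (\<lambda>x. (e x)\<^sup>2 / p x)"
    by (rule integrable_cong_AE_imp) (use ae in auto)
  have "(\<integral>x. (ips x)\<^sup>2 \<partial>M) = (\<integral>x. p x * (e x / p x)\<^sup>2 \<partial>M)"
    unfolding ips_def indicator_square by (rule integral_swap) simp
  also have "\<dots> = (\<integral>x. (e x)\<^sup>2 / p x \<partial>M)"
    by (rule integral_cong_AE) (use ae in auto)
  finally show "(\<integral>x. (ips x)\<^sup>2 \<partial>M) = (\<integral>x. (e x)\<^sup>2 / p x \<partial>M)" .
qed

lemma integral_ips: "(\<integral>x. ips x \<partial>M) = (\<integral>x. e x \<partial>M)"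
proof -
  have "(\<integral>x. ips x \<partial>M) = (\<integral>x. p x * (e x / p x) \<partial>M)"
    unfolding ips_def by (rule integral_swap) simp
  \<comment> \<open>Positivity is essential here: division by 0 gives 0, so where \<open>p\<close>
    vanishes the left integrand would be 0 instead of \<open>e\<close>.\<close>
  also have "\<dots> = (\<integral>x. e x \<partial>M)"
    by (rule integral_cong_AE) (use p_pos in auto)
  finally show ?thesis .
qed

text \<open>The Pythagorean identity with weight \<open>1 / p\<close>, obtained from the plain one for
  \<open>e / sqrt p\<close>.\<close>

lemma
  shows r2_over_p: "integrable M (\<lambda>x. (e x - g x)\<^sup>2 / p x)"
    and g2_over_p: "integrable M (\<lambda>x. (g x)\<^sup>2 / p x)"
    and e2_over_p_split: "(\<integral>x. (e x)\<^sup>2 / p x \<partial>M)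
        = (\<integral>x. (e x - g x)\<^sup>2 / p x \<partial>M) + (\<integral>x. (g x)\<^sup>2 / p x \<partial>M)"
proof -
  define h where "h x = (1 / sqrt (p x)) * e x" for x
  let ?h' = "real_cond_exp M F h"
  have [measurable]: "h \<in> borel_measurable M"
    unfolding h_def[abs_def] by measurable
  have h2: "AE x in M. (h x)\<^sup>2 = (e x)\<^sup>2 / p x"
    using p_pos by eventually_elim (simp add: h_def power_mult_distrib power_divide)
  have h_sq: "integrable M (\<lambda>x. (h x)\<^sup>2)"
    by (rule integrable_cong_AE_imp[OF e2_over_p]) (use h2[THEN AE_symmetric] in auto)
  have "integrable M h"
    by (rule square_integrable_imp_integrable) (use h_sq in auto)
  \<comment> \<open>The factor \<open>1 / sqrt p\<close> is \<open>F\<close>-measurable and can be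
    pulled out, so projection and residual of \<open>h\<close> are \<open>g / sqrt p\<close> and
    \<open>(e - g) / sqrt p\<close>. Their square integrability thus follows from that of
    \<open>h\<close>.\<close>
  then have "AE x in M. ?h' x = (1 / sqrt (p x)) * g x"
    unfolding h_def[abs_def] g_def by (intro F.real_cond_exp_mult) auto
  then have h'2: "AE x in M. (?h' x)\<^sup>2 = (g x)\<^sup>2 / p x"
    and r'2: "AE x in M. (h x - ?h' x)\<^sup>2 = (e x - g x)\<^sup>2 / p x"
    using p_pos
    by (eventually_elim, simp add: h_def power_divide flip: diff_divide_distrib)+
  have h'_sq: "integrable M (\<lambda>x. (?h' x)\<^sup>2)"
    by (rule F.cond_exp_square_integrable) (use h_sq in auto)
  have r'_sq: "integrable M (\<lambda>x. (h x - ?h' x)\<^sup>2)"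
    by (rule square_integrable_diff) (use h_sq h'_sq in auto)
  show "integrable M (\<lambda>x. (e x - g x)\<^sup>2 / p x)"
    by (rule integrable_cong_AE_imp[OF r'_sq]) (use r'2 in auto)
  show "integrable M (\<lambda>x. (g x)\<^sup>2 / p x)"
    by (rule integrable_cong_AE_imp[OF h'_sq]) (use h'2 in auto)
  have "(\<integral>x. (e x)\<^sup>2 / p x \<partial>M) = (\<integral>x. (h x)\<^sup>2 \<partial>M)"
    by (rule integral_cong_AE) (use h2 in auto)
  also have "\<dots> = (\<integral>x. (h x - ?h' x)\<^sup>2 \<partial>M) + (\<integral>x. (?h' x)\<^sup>2 \<partial>M)"
    by (rule F.cond_exp_pythagoras) (use h_sq in auto)
  also have "(\<integral>x. (h x - ?h' x)\<^sup>2 \<partial>M) = (\<integral>x. (e x - g x)\<^sup>2 / p x \<partial>M)"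
    by (rule integral_cong_AE) (use r'2 in auto)
  also have "(\<integral>x. (?h' x)\<^sup>2 \<partial>M) = (\<integral>x. (g x)\<^sup>2 / p x \<partial>M)"
    by (rule integral_cong_AE) (use h'2 in auto)
  finally show "(\<integral>x. (e x)\<^sup>2 / p x \<partial>M)
      = (\<integral>x. (e x - g x)\<^sup>2 / p x \<partial>M) + (\<integral>x. (g x)\<^sup>2 / p x \<partial>M)" .
qed

text \<open>For \<open>c = 1 / p\<close> the exposed residual gets the weight
  \<open>p * c\<^sup>2 = 1 / p\<close>, while the cross term gets \<open>p * c = 1\<close>, so that
  only \<open>g2\<close> is needed for the latter.\<close>

lemma dr_square_integrable: "integrable M (\<lambda>x. (dr x)\<^sup>2)"
  and dr_second_moment:
    "(\<integral>x. (dr x)\<^sup>2 \<partial>M) = (\<integral>x. (g x)\<^sup>2 \<partial>M) + (\<integral>x. (e x - g x)\<^sup>2 / p x \<partial>M)"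
proof -
  have ae: "AE x in M. p x * (1 / p x * (e x - g x))\<^sup>2 = (e x - g x)\<^sup>2 / p x"
    using p_pos by eventually_elim (simp add: power2_eq_square)
  have 1: "integrable M (\<lambda>x. p x * (1 / p x * (e x - g x))\<^sup>2)"
    by (rule integrable_cong_AE_imp[OF r2_over_p]) (use ae[THEN AE_symmetric] in auto)
  have 2: "integrable M (\<lambda>x. (p x * (1 / p x) * g x)\<^sup>2)"
    by (rule integrable_cong_AE_imp[OF g2]) (use p_pos in auto)
  note sm = second_moment_exposed_residual[of "\<lambda>x. 1 / p x", OF _ 2 1]
  show "integrable M (\<lambda>x. (dr x)\<^sup>2)"
    using sm(1) by (simp add: dr_def)
  have "(\<integral>x. p x * (1 / p x * (e x - g x))\<^sup>2 \<partial>M) = (\<integral>x. (e x - g x)\<^sup>2 / p x \<partial>M)"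
    by (rule integral_cong_AE) (use ae in auto)
  then show "(\<integral>x. (dr x)\<^sup>2 \<partial>M) = (\<integral>x. (g x)\<^sup>2 \<partial>M) + (\<integral>x. (e x - g x)\<^sup>2 / p x \<partial>M)"
    using sm(2) by (simp add: dr_def)
qed

lemma integral_dr: "(\<integral>x. dr x \<partial>M) = (\<integral>x. e x \<partial>M)"
proof -
  have i': "integrable M (\<lambda>x. p x * ((e x - g x) / p x))"
    by (rule integrable_cong_AE_imp[of _ "\<lambda>x. e x - g x"])
       (use e_integrable g_integrable p_pos in auto)
  then have i: "integrable M (\<lambda>x. indicator E x * ((e x - g x) / p x))"
    by (subst integrable_swap) auto
  have "(\<integral>x. indicator E x * ((e x - g x) / p x) \<partial>M) = (\<integral>x. p x * ((e x - g x) / p x) \<partial>M)"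
    by (rule integral_swap) simp
  also have "\<dots> = (\<integral>x. e x - g x \<partial>M)"
    by (rule integral_cong_AE) (use p_pos in auto)
  also have "\<dots> = 0"
    using e_integrable g_integrable integral_g by simp
  finally show ?thesis
    unfolding dr_def using g_integrable i integral_g by simp
qed

section \<open>Gaps between the second moments and their vanishing\<close>

lemma
  shows gap_dr_eib: "(\<integral>x. (dr x)\<^sup>2 \<partial>M) - (\<integral>x. (eib x)\<^sup>2 \<partial>M) = (\<integral>x. (1 / p x - p x) * s x \<partial>M)"
    and gap_dr_eib_integrable: "integrable M (\<lambda>x. (1 / p x - p x) * s x)"
proof -
  have i: "integrable M (\<lambda>x. (1 / p x - p x) * (e x - g x)\<^sup>2)"
    using Bochner_Integration.integrable_diff[OF r2_over_p integrable_p_mult[OF r2]]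
    by (simp add: left_diff_distrib)
  show "integrable M (\<lambda>x. (1 / p x - p x) * s x)"
    unfolding s_def by (rule F.real_cond_exp_intg(1)) (use i in auto)
  have "(\<integral>x. (dr x)\<^sup>2 \<partial>M) - (\<integral>x. (eib x)\<^sup>2 \<partial>M) = (\<integral>x. (1 / p x - p x) * (e x - g x)\<^sup>2 \<partial>M)"
    unfolding dr_second_moment eib_second_moment
    using r2_over_p integrable_p_mult[OF r2] by (simp add: left_diff_distrib)
  \<comment> \<open>The weight \<open>1 / p - p\<close> is \<open>F\<close>-measurable, so the
    squared residual may be replaced by its conditional expectation \<open>s\<close>; this puts the
    equality criterion in terms of the conditional variance.\<close>
  also have "\<dots> = (\<integral>x. (1 / p x - p x) * s x \<partial>M)"
    unfolding s_def by (rule F.real_cond_exp_intg(2)[symmetric]) (use i in auto)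
  finally show "(\<integral>x. (dr x)\<^sup>2 \<partial>M) - (\<integral>x. (eib x)\<^sup>2 \<partial>M) = (\<integral>x. (1 / p x - p x) * s x \<partial>M)" .
qed

text \<open>IPS and DR carry the same residual part, with weight \<open>1 / p\<close>; it cancels,
  and what remains is the weighted minus the plain second moment of \<open>g\<close>.\<close>

lemma
  shows gap_ips_dr: "(\<integral>x. (ips x)\<^sup>2 \<partial>M) - (\<integral>x. (dr x)\<^sup>2 \<partial>M) = (\<integral>x. (1 / p x - 1) * (g x)\<^sup>2 \<partial>M)"
    and gap_ips_dr_integrable: "integrable M (\<lambda>x. (1 / p x - 1) * (g x)\<^sup>2)"
  unfolding ips_second_moment dr_second_moment e2_over_p_split
  using g2_over_p g2 by (simp_all add: left_diff_distrib)

lemma gap_factors_nonneg: "AE x in M. 0 \<le> (1 / p x - p x) * s x \<and> 0 \<le> (1 / p x - 1) * (g x)\<^sup>2"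
  using p_pos p_range s_nonneg
proof eventually_elim
  case (elim x)
  then have "1 \<le> 1 / p x"
    by simp
  with elim have "p x \<le> 1 / p x"
    by linarith
  with elim \<open>1 \<le> 1 / p x\<close> show ?case
    by (intro conjI mult_nonneg_nonneg) simp_all
qed

lemma eib_le_dr: "(\<integral>x. (eib x)\<^sup>2 \<partial>M) \<le> (\<integral>x. (dr x)\<^sup>2 \<partial>M)"
proof -
  have "0 \<le> (\<integral>x. (1 / p x - p x) * s x \<partial>M)"
    by (rule integral_nonneg_AE) (use gap_factors_nonneg in auto)
  then show ?thesis
    using gap_dr_eib by simp
qed

lemma dr_le_ips: "(\<integral>x. (dr x)\<^sup>2 \<partial>M) \<le> (\<integral>x. (ips x)\<^sup>2 \<partial>M)"
proof -
  have "0 \<le> (\<integral>x. (1 / p x - 1) * (g x)\<^sup>2 \<partial>M)"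
    by (rule integral_nonneg_AE) (use gap_factors_nonneg in auto)
  then show ?thesis
    using gap_ips_dr by simp
qed

lemma eib_eq_dr_iff:
  "(\<integral>x. (eib x)\<^sup>2 \<partial>M) = (\<integral>x. (dr x)\<^sup>2 \<partial>M) \<longleftrightarrow> (AE x in M. p x = 1 \<or> s x = 0)"
proof -
  have "(\<integral>x. (eib x)\<^sup>2 \<partial>M) = (\<integral>x. (dr x)\<^sup>2 \<partial>M) \<longleftrightarrow> (\<integral>x. (1 / p x - p x) * s x \<partial>M) = 0"
    using gap_dr_eib by auto
  also have "\<dots> \<longleftrightarrow> (AE x in M. (1 / p x - p x) * s x = 0)"
    by (rule integral_nonneg_eq_0_iff_AE[OF gap_dr_eib_integrable])
       (use gap_factors_nonneg in auto)
  also have "\<dots> \<longleftrightarrow> (AE x in M. p x = 1 \<or> s x = 0)"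
  proof (rule eventually_subst)
    show "AE x in M. (1 / p x - p x) * s x = 0 \<longleftrightarrow> p x = 1 \<or> s x = 0"
      using p_pos
    proof eventually_elim
      case (elim x)
      \<comment> \<open>The other root of \<open>p * p = 1\<close>, namely -1, is excluded by
        positivity.\<close>
      then have "1 / p x - p x = 0 \<longleftrightarrow> p x * p x = 1"
        by (auto simp: field_simps)
      with elim show ?case
        by (auto simp: square_eq_1_iff)
    qed
  qed
  finally show ?thesis .
qed

lemma dr_eq_ips_iff:
  "(\<integral>x. (dr x)\<^sup>2 \<partial>M) = (\<integral>x. (ips x)\<^sup>2 \<partial>M) \<longleftrightarrow> (AE x in M. p x = 1 \<or> g x = 0)"
proof -
  have "(\<integral>x. (dr x)\<^sup>2 \<partial>M) = (\<integral>x. (ips x)\<^sup>2 \<partial>M) \<longleftrightarrow> (\<integral>x. (1 / p x - 1) * (g x)\<^sup>2 \<partial>M) = 0"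
    using gap_ips_dr by auto
  also have "\<dots> \<longleftrightarrow> (AE x in M. (1 / p x - 1) * (g x)\<^sup>2 = 0)"
    by (rule integral_nonneg_eq_0_iff_AE[OF gap_ips_dr_integrable])
       (use gap_factors_nonneg in auto)
  also have "\<dots> \<longleftrightarrow> (AE x in M. p x = 1 \<or> g x = 0)"
    by (rule eventually_subst) (use p_pos in \<open>eventually_elim, auto simp: field_simps\<close>)
  finally show ?thesis .
qed

end

end

section \<open>Independence, factorization and divergence\<close>

lemma (in prob_space) square_mean_le:
  fixes Y :: "'a \<Rightarrow> real"
  assumes [measurable]: "Y \<in> borel_measurable M" and Y2: "integrable M (\<lambda>\<omega>. (Y \<omega>)\<^sup>2)"
  shows "(expectation Y)\<^sup>2 \<le> expectation (\<lambda>\<omega>. (Y \<omega>)\<^sup>2)"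
proof -
  have "integrable M Y"
    by (rule square_integrable_imp_integrable) (use Y2 in auto)
  then show ?thesis
    using variance_positive[of Y] variance_eq[of Y] Y2 by simp
qed

text \<open>On the set \<open>S\<close> where \<phi> is nonzero, which has positive probability, the
  quotients tend to infinity. The weights need not decrease in \<open>n\<close>, so monotone
  convergence does not apply; cutting the quotients at \<open>K\<close> on \<open>S\<close> gives a
  bounded sequence whose integrals tend to \<open>K * prob S\<close>, and \<open>K\<close> is
  arbitrary.\<close>

lemma (in prob_space) integral_quotient_blowup:
  fixes \<phi> :: "'a \<Rightarrow> real" and w :: "nat \<Rightarrow> 'a \<Rightarrow> real"
  assumes [measurable]: "\<phi> \<in> borel_measurable M" and [measurable]: "\<And>n. w n \<in> borel_measurable M"
    and nonneg: "\<And>\<omega>. 0 \<le> \<phi> \<omega>" and nz: "\<not> (AE \<omega> in M. \<phi> \<omega> = 0)"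
    and w_pos: "\<And>n. AE \<omega> in M. 0 < w n \<omega>" and w_0: "AE \<omega> in M. (\<lambda>n. w n \<omega>) \<longlonglongrightarrow> 0"
    and int: "\<And>n. integrable M (\<lambda>\<omega>. \<phi> \<omega> / w n \<omega>)"
  shows "filterlim (\<lambda>n. \<integral>\<omega>. \<phi> \<omega> / w n \<omega> \<partial>M) at_top sequentially"
proof -
  define S where "S = {\<omega> \<in> space M. \<phi> \<omega> \<noteq> 0}"
  have S [measurable]: "S \<in> sets M"
    unfolding S_def by measurable
  have "prob S \<noteq> 0"
    using nz prob_eq_0[OF S] by (auto simp: S_def)
  then have S_pos: "0 < prob S"
    using measure_nonneg[of M S] by linarith
  have pos: "AE \<omega> in M. \<forall>n. 0 < w n \<omega>"
    using w_pos by (simp add: AE_all_countable)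
  show ?thesis
    unfolding filterlim_at_top
  proof
    fix Z :: real
    \<comment> \<open>Chosen so that the limit of the truncated integrals is \<bar>Z\<bar> + 1,
      strictly above \<open>Z\<close>.\<close>
    define K where "K = (\<bar>Z\<bar> + 1) / prob S"
    have K: "0 \<le> K" "K * prob S = \<bar>Z\<bar> + 1"
      using S_pos by (simp_all add: K_def)
    let ?\<psi> = "\<lambda>n \<omega>. min (\<phi> \<omega> / w n \<omega>) (K * indicator S \<omega>)"
    have "(\<lambda>n. \<integral>\<omega>. ?\<psi> n \<omega> \<partial>M) \<longlonglongrightarrow> (\<integral>\<omega>. K * indicator S \<omega> \<partial>M)"
    proof (rule integral_dominated_convergence[where w = "\<lambda>_. K"])
      show "AE \<omega> in M. (\<lambda>n. ?\<psi> n \<omega>) \<longlonglongrightarrow> K * indicator S \<omega>"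
        using pos w_0 AE_space
      proof eventually_elim
        case (elim \<omega>)
        show ?case
        proof (cases "\<omega> \<in> S")
          case True
          then have \<phi>: "0 < \<phi> \<omega>"
            using nonneg[of \<omega>] by (simp add: S_def)
          have "filterlim (\<lambda>n. \<phi> \<omega> / w n \<omega>) at_top sequentially"
            by (rule LIM_at_top_divide[OF tendsto_const \<phi>]) (use elim in auto)
          then have "\<forall>\<^sub>F n in sequentially. K \<le> \<phi> \<omega> / w n \<omega>"
            by (simp add: filterlim_at_top)
          then have "\<forall>\<^sub>F n in sequentially. ?\<psi> n \<omega> = K * indicator S \<omega>"
            by eventually_elim (use True in simp)
          then show ?thesis
            by (rule tendsto_eventually)
        next
          case False
          with elim show ?thesis
            by (simp add: S_def)
        qed
      qed
      show "AE \<omega> in M. norm (?\<psi> n \<omega>) \<le> K" for n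
        using pos
      proof eventually_elim
        case (elim \<omega>)
        have "0 \<le> \<phi> \<omega> / w n \<omega>"
          using nonneg[of \<omega>] elim by (simp add: less_imp_le)
        then have "0 \<le> ?\<psi> n \<omega>"
          using K by simp
        moreover have "?\<psi> n \<omega> \<le> K * indicator S \<omega>"
          by simp
        moreover have "K * indicator S \<omega> \<le> K"
          using K by (simp add: indicator_def)
        ultimately show ?case
          by (simp only: real_norm_def abs_of_nonneg)
      qed
    qed simp_all
    also have "(\<integral>\<omega>. K * indicator S \<omega> \<partial>M) = \<bar>Z\<bar> + 1"
      using K by simp
    finally have ev: "\<forall>\<^sub>F n in sequentially. Z < (\<integral>\<omega>. ?\<psi> n \<omega> \<partial>M)"
      by (rule order_tendstoD) simp
    have "(\<integral>\<omega>. ?\<psi> n \<omega> \<partial>M) \<le> (\<integral>\<omega>. \<phi> \<omega> / w n \<omega> \<partial>M)" for n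
    proof (rule integral_mono_AE)
      show "integrable M (?\<psi> n)"
        by (intro integrable_min int) (simp add: integrable_indicator_iff emeasure_eq_measure)
    qed (use int in auto)
    then show "\<forall>\<^sub>F n in sequentially. Z \<le> (\<integral>\<omega>. \<phi> \<omega> / w n \<omega> \<partial>M)"
      by (intro eventually_mono[OF ev]) (rule order_trans[OF less_imp_le])
  qed
qed

text \<open>One divergent summand is enough because the nonnegative others cannot compensate it.
  This is why the variance contribution of every pair is shown to be nonnegative later.\<close>

lemma filterlim_sum_at_top:
  fixes t :: "nat \<Rightarrow> 'd \<Rightarrow> real"
  assumes "finite D" "d \<in> D" "0 < c"
    and nonneg: "\<And>n d. d \<in> D \<Longrightarrow> 0 \<le> t n d"
    and top: "filterlim (\<lambda>n. t n d) at_top sequentially"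
  shows "filterlim (\<lambda>n. (\<Sum>d\<in>D. t n d) / c) at_top sequentially"
proof (rule filterlim_at_top_mono)
  show "filterlim (\<lambda>n. t n d * (1 / c)) at_top sequentially"
    by (rule filterlim_at_top_mult_tendsto_pos[OF tendsto_const _ top]) (use assms(3) in simp)
  show "\<forall>\<^sub>F n in sequentially. t n d * (1 / c) \<le> (\<Sum>d\<in>D. t n d) / c"
  proof (rule always_eventually, rule allI)
    fix n
    have "t n d \<le> (\<Sum>d\<in>D. t n d)"
      by (rule member_le_sum) (use assms in auto)
    then show "t n d * (1 / c) \<le> (\<Sum>d\<in>D. t n d) / c"
      using assms(3) by (simp add: divide_right_mono)
  qed
qed

section \<open>Sums of independent terms\<close>

lemma (in prob_space) variance_sum_indep:
  fixes Y :: "'i \<Rightarrow> 'a \<Rightarrow> real"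
  assumes D: "finite D" and ind: "indep_vars (\<lambda>_. borel) Y D"
    and sq: "\<And>d. d \<in> D \<Longrightarrow> integrable M (\<lambda>\<omega>. (Y d \<omega>)\<^sup>2)"
  shows "variance (\<lambda>\<omega>. \<Sum>d\<in>D. Y d \<omega>) = (\<Sum>d\<in>D. variance (Y d))"
proof -
  have [measurable]: "Y d \<in> borel_measurable M" if "d \<in> D" for d
    using ind that by (auto simp: indep_vars_def)
  have int: "integrable M (Y d)" if "d \<in> D" for d
    by (rule square_integrable_imp_integrable) (use sq that in auto)
  \<comment> \<open>After centring, the variance of the sum is the double sum of the expectations of
    \<open>Z d * Z d'\<close>, and independence makes every off-diagonal one a product of
    zeros.\<close>
  define Z where "Z d \<omega> = Y d \<omega> - expectation (Y d)" for d \<omega>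
  have Zm [measurable]: "Z d \<in> borel_measurable M" if "d \<in> D" for d
    unfolding Z_def[abs_def] using that by measurable
  have Zi: "integrable M (Z d)" "expectation (Z d) = 0" if "d \<in> D" for d
    unfolding Z_def[abs_def] using int[OF that] prob_space by simp_all
  have Z2: "integrable M (\<lambda>\<omega>. (Z d \<omega>)\<^sup>2)" if "d \<in> D" for d
    unfolding Z_def by (rule square_integrable_diff) (use sq that in auto)
  have Zind: "indep_vars (\<lambda>_. borel) Z D"
    unfolding Z_def[abs_def] by (rule indep_vars_compose2[OF ind]) auto
  have ZZi: "integrable M (\<lambda>\<omega>. Z d \<omega> * Z d' \<omega>)" if "d \<in> D" "d' \<in> D" for d d'
    by (rule square_integrable_mult) (use Z2 that in auto)
  have ZZ: "expectation (\<lambda>\<omega>. Z d \<omega> * Z d' \<omega>) = (if d = d' then variance (Y d) else 0)"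
    if "d \<in> D" "d' \<in> D" for d d'
  proof (cases "d = d'")
    case True
    then show ?thesis
      by (simp add: Z_def power2_eq_square)
  next
    case False
    have "indep_vars (\<lambda>_. borel) Z {d, d'}"
      using indep_vars_subset[OF Zind] that by auto
    from indep_vars_lebesgue_integral[OF _ this] have
      "expectation (\<lambda>\<omega>. \<Prod>i\<in>{d, d'}. Z i \<omega>) = (\<Prod>i\<in>{d, d'}. expectation (Z i))"
      using Zi that by auto
    then show ?thesis
      using False Zi that by simp
  qed
  have "expectation (\<lambda>\<omega>. \<Sum>d\<in>D. Y d \<omega>) = (\<Sum>d\<in>D. expectation (Y d))"
    by (rule Bochner_Integration.integral_sum) (rule int)
  then have "variance (\<lambda>\<omega>. \<Sum>d\<in>D. Y d \<omega>) = expectation (\<lambda>\<omega>. \<Sum>d\<in>D. \<Sum>d'\<in>D. Z d \<omega> * Z d' \<omega>)"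
    by (simp add: Z_def power2_eq_square sum_product flip: sum_subtractf)
  also have "\<dots> = (\<Sum>d\<in>D. \<Sum>d'\<in>D. expectation (\<lambda>\<omega>. Z d \<omega> * Z d' \<omega>))"
    using ZZi by (subst Bochner_Integration.integral_sum) auto
  also have "\<dots> = (\<Sum>d\<in>D. \<Sum>d'\<in>D. if d = d' then variance (Y d) else 0)"
    using ZZ by (intro sum.cong refl) auto
  also have "\<dots> = (\<Sum>d\<in>D. variance (Y d))"
    using D by simp
  finally show ?thesis .
qed

text \<open>The terms of the estimators contain conditional expectations, which come without an
  explicit formula in the tuple. Independence only concerns generated sigma-algebras, so
  measurability with respect to that of \<open>T i\<close> is enough.\<close>

lemma (in prob_space) indep_vars_vimage_measurable:
  assumes ind: "indep_vars N T I"
    and Y: "\<And>i. i \<in> I \<Longrightarrow> Y i \<in> measurable (vimage_algebra (space M) (T i) (N i)) (K i)"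
  shows "indep_vars K Y I"
proof -
  have T: "T i \<in> measurable M (N i)" if "i \<in> I" for i
    using ind that by (auto simp: indep_vars_def2)
  then have sets: "sets (vimage_algebra (space M) (T i) (N i)) = {T i -` A \<inter> space M | A. A \<in> sets (N i)}"
    if "i \<in> I" for i
    using that by (intro sets_vimage_algebra2) (auto dest: measurable_space)
  have "sets (vimage_algebra (space M) (T i) (N i)) \<subseteq> sets M" if "i \<in> I" for i
    using sets[OF that] T[OF that] by (auto intro: measurable_sets)
  then have "Y i \<in> measurable M (K i)" if "i \<in> I" for i
    using measurable_from_subalg[of M "vimage_algebra (space M) (T i) (N i)" "Y i" "K i"] Y that
    by (auto simp: subalgebra_def)
  moreover have "indep_sets (\<lambda>i. {Y i -` A \<inter> space M | A. A \<in> sets (K i)}) I"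
  proof (rule indep_sets_mono_sets)
    show "indep_sets (\<lambda>i. {T i -` A \<inter> space M | A. A \<in> sets (N i)}) I"
      using ind by (simp add: indep_vars_def2)
    show "{Y i -` A \<inter> space M | A. A \<in> sets (K i)} \<subseteq> {T i -` A \<inter> space M | A. A \<in> sets (N i)}"
      if "i \<in> I" for i
      using measurable_sets[OF Y[OF that]] sets[OF that] by auto
  qed
  ultimately show ?thesis
    by (simp add: indep_vars_def2)
qed

section \<open>Doob-Dynkin factorization through a generated sigma-algebra\<close>

lemma factor_through_vimage_algebra_ennreal:
  assumes T: "T \<in> \<Omega> \<rightarrow> space N" and u: "u \<in> borel_measurable (vimage_algebra \<Omega> T N)"
  shows "\<exists>h \<in> borel_measurable N. \<forall>x\<in>\<Omega>. (u x :: ennreal) = h (T x)"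
  using u
proof (induction rule: borel_measurable_induct)
  case (cong u v)
  then show ?case
    by (metis space_vimage_algebra)
next
  case (set A)
  then obtain B where B: "B \<in> sets N" "A = T -` B \<inter> \<Omega>"
    by (auto simp: sets_vimage_algebra2[OF T])
  show ?case
    by (rule bexI[of _ "indicator B"]) (simp_all add: B borel_measurable_indicator split: split_indicator)
next
  case (mult u c)
  from mult.IH obtain h where h [measurable]: "h \<in> borel_measurable N" "\<forall>x\<in>\<Omega>. u x = h (T x)"
    by blast
  show ?case
    by (rule bexI[of _ "\<lambda>y. c * h y"]) (simp_all add: h)
next
  case (add u v)
  from add.IH obtain h k where h [measurable]: "h \<in> borel_measurable N" "\<forall>x\<in>\<Omega>. u x = h (T x)"
    and k [measurable]: "k \<in> borel_measurable N" "\<forall>x\<in>\<Omega>. v x = k (T x)"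
    by blast
  show ?case
    by (rule bexI[of _ "\<lambda>y. k y + h y"]) (simp_all add: h k)
next
  case (seq U)
  have "\<exists>h. \<forall>i. h i \<in> borel_measurable N \<and> (\<forall>x\<in>\<Omega>. U i x = h i (T x))"
    by (rule choice) (use seq.IH in \<open>simp add: Bex_def\<close>)
  then obtain h where "\<forall>i. h i \<in> borel_measurable N \<and> (\<forall>x\<in>\<Omega>. U i x = h i (T x))" ..
  then have h [measurable]: "\<And>i. h i \<in> borel_measurable N" "\<And>i. \<forall>x\<in>\<Omega>. U i x = h i (T x)"
    by simp_all
  have "(SUP i. U i) x = (SUP i. h i (T x))" if "x \<in> \<Omega>" for x
    unfolding SUP_apply using h(2) that by (intro SUP_cong) auto
  moreover have "(\<lambda>y. SUP i. h i y) \<in> borel_measurable N"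
    by measurable
  ultimately show ?case
    by (intro bexI[of _ "\<lambda>y. SUP i. h i y"] ballI)
qed

text \<open>The nonnegative case, applied to the positive and the negative part. It turns a
  conditional expectation given the feature into a function on feature values, which can then be
  evaluated in another model.\<close>

lemma factor_through_vimage_algebra:
  fixes u :: "'a \<Rightarrow> real"
  assumes T: "T \<in> \<Omega> \<rightarrow> space N" and [measurable]: "u \<in> borel_measurable (vimage_algebra \<Omega> T N)"
  obtains h where "h \<in> borel_measurable N" "\<And>x. x \<in> \<Omega> \<Longrightarrow> u x = h (T x)"
proof -
  have "(\<lambda>x. ennreal (u x)) \<in> borel_measurable (vimage_algebra \<Omega> T N)"
    "(\<lambda>x. ennreal (- u x)) \<in> borel_measurable (vimage_algebra \<Omega> T N)"
    by measurable
  note uv = this[THEN factor_through_vimage_algebra_ennreal[OF T]]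
  from uv(1) obtain h where [measurable]: "h \<in> borel_measurable N"
    and h: "\<forall>x\<in>\<Omega>. ennreal (u x) = h (T x)"
    by blast
  from uv(2) obtain k where [measurable]: "k \<in> borel_measurable N"
    and k: "\<forall>x\<in>\<Omega>. ennreal (- u x) = k (T x)"
    by blast
  \<comment> \<open>\<open>ennreal\<close> cuts negative numbers to 0, so the two terms are the
    positive and the negative part of \<open>r\<close>.\<close>
  have split: "r = enn2real (ennreal r) - enn2real (ennreal (- r))" for r
    by (cases "0 \<le> r") (simp_all add: ennreal_neg)
  show thesis
  proof (rule that)
    show "(\<lambda>y. enn2real (h y) - enn2real (k y)) \<in> borel_measurable N"
      by measurable
    show "u x = enn2real (h (T x)) - enn2real (k (T x))" if "x \<in> \<Omega>" for x
      using split[of "u x"] h[rule_format, OF that] k[rule_format, OF that] by (simp only:)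
  qed
qed

section \<open>Generated sigma-algebras and enlarging the conditioning\<close>

lemma subalgebra_vimage_algebra:
  assumes "T \<in> measurable M N"
  shows "subalgebra M (vimage_algebra (space M) T N)"
proof -
  have "T \<in> space M \<rightarrow> space N"
    using measurable_space[OF assms] by (rule funcsetI)
  then show ?thesis
    using measurable_sets[OF assms] by (auto simp: subalgebra_def sets_vimage_algebra2)
qed

lemma measurable_compose_vimage_algebra:
  assumes "T \<in> measurable M N" "h \<in> measurable N K"
  shows "(\<lambda>x. h (T x)) \<in> measurable (vimage_algebra (space M) T N) K"
proof (rule measurable_compose[OF measurable_vimage_algebra1 assms(2)])
  show "T \<in> space M \<rightarrow> space N"
    using measurable_space[OF assms(1)] by (rule funcsetI)
qed

text \<open>The hypothesis settles the rectangles \<open>S \<in> A\<close>, \<open>Y \<in> B\<close>, an intersection-stable generator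
  of the larger \<open>\<sigma>\<close>-algebra.\<close>

lemma (in prob_space) cond_exp_indicator_enlarge:
  fixes S :: "'a \<Rightarrow> 'x" and Y :: "'a \<Rightarrow> 'y" and X N
  defines "F \<equiv> vimage_algebra (space M) S X"
    and "G \<equiv> vimage_algebra (space M) (\<lambda>\<omega>. (S \<omega>, Y \<omega>)) (X \<Otimes>\<^sub>M N)"
  assumes S [measurable]: "S \<in> measurable M X" and Y [measurable]: "Y \<in> measurable M N"
    and E [measurable]: "E \<in> sets M"
    and indep: "\<And>B. B \<in> sets N \<Longrightarrow> AE \<omega> in M.
        real_cond_exp M F (indicator ({\<omega> \<in> space M. Y \<omega> \<in> B} \<inter> E)) \<omega> =
        real_cond_exp M F (indicator {\<omega> \<in> space M. Y \<omega> \<in> B}) \<omega> * real_cond_exp M F (indicator E) \<omega>"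
  shows "AE \<omega> in M. real_cond_exp M G (indicator E) \<omega> = real_cond_exp M F (indicator E) \<omega>"
proof -
  let ?T = "\<lambda>\<omega>. (S \<omega>, Y \<omega>)"
  have T [measurable]: "?T \<in> measurable M (X \<Otimes>\<^sub>M N)"
    by measurable
  have MF: "subalgebra M F"
    unfolding F_def by (rule subalgebra_vimage_algebra) simp
  have MG: "subalgebra M G"
    unfolding G_def by (rule subalgebra_vimage_algebra) simp
  have [measurable]: "S \<in> measurable G X"
    using measurable_compose_vimage_algebra[OF T measurable_fst] by (simp add: G_def)
  have "subalgebra G (vimage_algebra (space G) S X)"
    by (rule subalgebra_vimage_algebra) simp
  then have GF: "subalgebra G F"
    by (simp add: F_def G_def)
  interpret F: finite_measure_subalgebra M F
    by standard (rule MF)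
  interpret G: finite_measure_subalgebra M G
    by standard (rule MG)
  define p where "p = real_cond_exp M F (indicator E)"
  have p_F [measurable]: "p \<in> borel_measurable F"
    by (simp add: p_def)
  have p_M [measurable]: "p \<in> borel_measurable M"
    by (rule measurable_from_subalg[OF MF]) simp
  have ind_int: "integrable M (indicator A :: 'a \<Rightarrow> real)" if "A \<in> sets M" for A
    using that by (simp add: integrable_indicator_iff emeasure_eq_measure)
  have p_int: "integrable M p"
    unfolding p_def by (rule F.real_cond_exp_int(1)[OF ind_int[OF E]])
  have p_nonneg: "AE \<omega> in M. 0 \<le> p \<omega>"
    unfolding p_def by (rule F.real_cond_exp_pos) auto

  \<comment> \<open>Every set of \<open>G\<close> is a preimage under \<open>?T\<close>, so the
    claim amounts to equality of the image measures under \<open>?T\<close> for the densities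
    \<open>indicator E\<close> and \<open>p\<close>.\<close>
  let ?\<mu> = "distr (density M (\<lambda>\<omega>. ennreal (indicator E \<omega>))) (X \<Otimes>\<^sub>M N) ?T"
  let ?\<nu> = "distr (density M (\<lambda>\<omega>. ennreal (p \<omega>))) (X \<Otimes>\<^sub>M N) ?T"
  have \<mu>: "emeasure ?\<mu> C = ennreal (\<integral>\<omega>. indicator E \<omega> * indicator (?T -` C \<inter> space M) \<omega> \<partial>M)"
    if C: "C \<in> sets (X \<Otimes>\<^sub>M N)" for C
  proof -
    have [measurable]: "?T -` C \<inter> space M \<in> sets M"
      by (rule measurable_sets[OF T C])
    have "emeasure ?\<mu> C = (\<integral>\<^sup>+\<omega>. ennreal (indicator E \<omega> * indicator (?T -` C \<inter> space M) \<omega>) \<partial>M)"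
      using C by (simp add: emeasure_distr emeasure_density ennreal_mult' ennreal_indicator)
    also have "\<dots> = ennreal (\<integral>\<omega>. indicator E \<omega> * indicator (?T -` C \<inter> space M) \<omega> \<partial>M)"
      by (intro nn_integral_eq_integral integrable_real_mult_indicator ind_int) auto
    finally show ?thesis .
  qed
  have \<nu>: "emeasure ?\<nu> C = ennreal (\<integral>\<omega>. p \<omega> * indicator (?T -` C \<inter> space M) \<omega> \<partial>M)"
    if C: "C \<in> sets (X \<Otimes>\<^sub>M N)" for C
  proof -
    have [measurable]: "?T -` C \<inter> space M \<in> sets M"
      by (rule measurable_sets[OF T C])
    have "emeasure ?\<nu> C = (\<integral>\<^sup>+\<omega>. ennreal (p \<omega>) * indicator (?T -` C \<inter> space M) \<omega> \<partial>M)"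
      using C by (simp add: emeasure_distr emeasure_density)
    also have "\<dots> = (\<integral>\<^sup>+\<omega>. ennreal (p \<omega> * indicator (?T -` C \<inter> space M) \<omega>) \<partial>M)"
      by (intro nn_integral_cong) (simp add: indicator_def)
    also have "\<dots> = ennreal (\<integral>\<omega>. p \<omega> * indicator (?T -` C \<inter> space M) \<omega> \<partial>M)"
      using p_nonneg by (intro nn_integral_eq_integral integrable_real_mult_indicator p_int) auto
    finally show ?thesis .
  qed
  have rect: "(\<integral>\<omega>. indicator E \<omega> * indicator (?T -` (A \<times> B) \<inter> space M) \<omega> \<partial>M)
      = (\<integral>\<omega>. p \<omega> * indicator (?T -` (A \<times> B) \<inter> space M) \<omega> \<partial>M)"
    if A: "A \<in> sets X" and B: "B \<in> sets N" for A B
  proof -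
    let ?A = "S -` A \<inter> space M" and ?B = "{\<omega> \<in> space M. Y \<omega> \<in> B}"
    have AF [measurable]: "?A \<in> sets F"
      unfolding F_def by (rule in_vimage_algebra[OF A])
    have [measurable]: "?A \<in> sets M" "?B \<in> sets M"
      using A B by measurable
    have i: "integrable M (\<lambda>\<omega>. (indicator ?A \<omega> :: real) * indicator (?B \<inter> E) \<omega>)"
      by (intro integrable_real_mult_indicator ind_int) auto
    have pA: "(\<lambda>\<omega>. p \<omega> * indicator ?A \<omega>) \<in> borel_measurable F"
      by measurable
    have "(\<integral>\<omega>. indicator E \<omega> * indicator (?T -` (A \<times> B) \<inter> space M) \<omega> \<partial>M)
        = (\<integral>\<omega>. (indicator ?A \<omega> :: real) * indicator (?B \<inter> E) \<omega> \<partial>M)"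
      by (intro Bochner_Integration.integral_cong refl) (auto simp: indicator_def)
    also have "\<dots> = (\<integral>\<omega>. indicator ?A \<omega> * real_cond_exp M F (indicator (?B \<inter> E)) \<omega> \<partial>M)"
      by (rule F.real_cond_exp_intg(2)[OF i, symmetric]) auto
    also have "\<dots> = (\<integral>\<omega>. (p \<omega> * indicator ?A \<omega>) * real_cond_exp M F (indicator ?B) \<omega> \<partial>M)"
    proof (rule integral_cong_AE)
      show "AE \<omega> in M. indicator ?A \<omega> * real_cond_exp M F (indicator (?B \<inter> E)) \<omega>
          = (p \<omega> * indicator ?A \<omega>) * real_cond_exp M F (indicator ?B) \<omega>"
        using indep[OF B] by eventually_elim (simp add: p_def)
    qed measurable
    \<comment> \<open>Conditioning on \<open>F\<close> is undone for \<open>?B\<close> alone: the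
      other factor, \<open>p\<close> times the indicator of \<open>?A\<close>, is
      \<open>F\<close>-measurable.\<close>
    also have "\<dots> = (\<integral>\<omega>. (p \<omega> * indicator ?A \<omega>) * indicator ?B \<omega> \<partial>M)"
      by (rule F.real_cond_exp_intg(2)[OF _ pA])
         (use p_int in \<open>auto intro!: integrable_real_mult_indicator\<close>)
    also have "\<dots> = (\<integral>\<omega>. p \<omega> * indicator (?T -` (A \<times> B) \<inter> space M) \<omega> \<partial>M)"
      by (intro Bochner_Integration.integral_cong refl) (auto simp: indicator_def)
    finally show ?thesis .
  qed
  have eq: "?\<mu> = ?\<nu>"
  proof (rule measure_eqI_generator_eq[OF Int_stable_pair_measure_generator[of X N],
        where A = "\<lambda>_. space X \<times> space N"])
    show "{a \<times> b |a b. a \<in> sets X \<and> b \<in> sets N} \<subseteq> Pow (space X \<times> space N)"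
      by (rule pair_measure_closed)
    show "emeasure ?\<mu> C = emeasure ?\<nu> C" if C: "C \<in> {a \<times> b |a b. a \<in> sets X \<and> b \<in> sets N}" for C
    proof -
      from C obtain A B where AB: "A \<in> sets X" "B \<in> sets N" "C = A \<times> B"
        by blast
      then have "C \<in> sets (X \<Otimes>\<^sub>M N)"
        by simp
      from \<mu>[OF this] \<nu>[OF this] rect[OF AB(1,2)] AB(3) show ?thesis
        by simp
    qed
    show "emeasure ?\<mu> (space X \<times> space N) \<noteq> \<infinity>"
      using \<mu>[of "space X \<times> space N"] by simp
    show "sets ?\<mu> = sigma_sets (space X \<times> space N) {a \<times> b |a b. a \<in> sets X \<and> b \<in> sets N}"
      "sets ?\<nu> = sigma_sets (space X \<times> space N) {a \<times> b |a b. a \<in> sets X \<and> b \<in> sets N}"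
      by (simp_all add: sets_pair_measure)
    show "range (\<lambda>_. space X \<times> space N) \<subseteq> {a \<times> b |a b. a \<in> sets X \<and> b \<in> sets N}"
      by blast
  qed simp_all
  show ?thesis
    unfolding p_def[symmetric]
  proof (rule G.real_cond_exp_charact)
    fix A assume "A \<in> sets G"
    moreover have "?T \<in> space M \<rightarrow> space (X \<Otimes>\<^sub>M N)"
      using measurable_space[OF T] by (rule funcsetI)
    ultimately obtain C where C: "C \<in> sets (X \<Otimes>\<^sub>M N)" and A: "A = ?T -` C \<inter> space M"
      unfolding G_def by (auto simp: sets_vimage_algebra2)
    have "ennreal (\<integral>\<omega>. indicator E \<omega> * indicator A \<omega> \<partial>M) = ennreal (\<integral>\<omega>. p \<omega> * indicator A \<omega> \<partial>M)"
      using \<mu>[OF C] \<nu>[OF C] eq A by simp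
    \<comment> \<open>Nonnegativity is needed to strip \<open>ennreal\<close>, which identifies all
      negative numbers with 0.\<close>
    moreover have "0 \<le> (\<integral>\<omega>. p \<omega> * indicator A \<omega> \<partial>M)"
      using p_nonneg by (intro integral_nonneg_AE) auto
    ultimately have "(\<integral>\<omega>. indicator E \<omega> * indicator A \<omega> \<partial>M) = (\<integral>\<omega>. p \<omega> * indicator A \<omega> \<partial>M)"
      by (simp add: integral_nonneg_AE)
    then show "set_lebesgue_integral M A (indicator E) = set_lebesgue_integral M A p"
      by (simp add: set_lebesgue_integral_def mult.commute)
  next
    show "p \<in> borel_measurable G"
      by (rule measurable_from_subalg[OF GF]) simp
  qed (use ind_int p_int in auto)
qed

section \<open>The estimators of a model\<close>

context rec_setting
begin

abbreviation "M \<equiv> pspace m"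

text \<open>The largest of three nested sigma-algebras. The feature alone is what one conditions on,
  feature and potential outcome determine the error, and only the full tuple contains the exposure;
  independence across pairs is independence of the sigma-algebras of the tuples.\<close>

definition tuple_algebra :: "'d \<Rightarrow> 'a measure" where
  "tuple_algebra d = vimage_algebra (space M) (tuple m d) (tuple_space X)"

definition feat_pot_algebra :: "'d \<Rightarrow> 'a measure" where
  "feat_pot_algebra d = vimage_algebra (space M) (\<lambda>\<omega>. (feat m d \<omega>, pot m d \<omega>)) (X \<Otimes>\<^sub>M borel)"

definition exposed :: "'d \<Rightarrow> 'a set" where
  "exposed d = {\<omega> \<in> space M. obs m d \<omega>}"

context
  fixes d assumes d: "d \<in> D"
begin

lemma
  shows feat_T: "feat m d \<in> measurable (tuple_algebra d) X"
    and obs_T: "obs m d \<in> measurable (tuple_algebra d) (count_space UNIV)"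
    and pot_T: "pot m d \<in> borel_measurable (tuple_algebra d)"
proof -
  note T = measurable_compose_vimage_algebra[OF tuple_measurable[OF d], folded tuple_algebra_def]
  have "fst \<in> measurable (tuple_space X) X"
    "(\<lambda>t. fst (snd t)) \<in> measurable (tuple_space X) (count_space UNIV)"
    "(\<lambda>t. snd (snd (snd t))) \<in> borel_measurable (tuple_space X)"
    unfolding tuple_space_def by measurable
  from this[THEN T] show "feat m d \<in> measurable (tuple_algebra d) X"
    "obs m d \<in> measurable (tuple_algebra d) (count_space UNIV)"
    "pot m d \<in> borel_measurable (tuple_algebra d)"
    by (simp_all add: tuple_def)
qed

lemma MT: "subalgebra M (tuple_algebra d)"
  unfolding tuple_algebra_def by (rule subalgebra_vimage_algebra[OF tuple_measurable[OF d]])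

lemma
  shows feat_M [measurable]: "feat m d \<in> measurable M X"
    and obs_M [measurable]: "obs m d \<in> measurable M (count_space UNIV)"
    and pot_M [measurable]: "pot m d \<in> borel_measurable M"
  using measurable_from_subalg[OF MT] feat_T obs_T pot_T by blast+

lemma MG: "subalgebra M (feat_pot_algebra d)"
  unfolding feat_pot_algebra_def by (rule subalgebra_vimage_algebra) simp

lemma feat_pot_algebra_le_tuple_algebra: "subalgebra (tuple_algebra d) (feat_pot_algebra d)"
proof -
  note feat_T [measurable] pot_T [measurable]
  have "subalgebra (tuple_algebra d)
      (vimage_algebra (space (tuple_algebra d)) (\<lambda>\<omega>. (feat m d \<omega>, pot m d \<omega>)) (X \<Otimes>\<^sub>M borel))"
    by (rule subalgebra_vimage_algebra) simp
  then show ?thesis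
    by (simp add: feat_pot_algebra_def tuple_algebra_def)
qed

lemma GF: "subalgebra (feat_pot_algebra d) (feat_algebra X m d)"
proof -
  have "(\<lambda>\<omega>. (feat m d \<omega>, pot m d \<omega>)) \<in> measurable M (X \<Otimes>\<^sub>M borel)"
    by measurable
  from measurable_compose_vimage_algebra[OF this measurable_fst]
  have "feat m d \<in> measurable (feat_pot_algebra d) X"
    by (simp add: feat_pot_algebra_def)
  then have "subalgebra (feat_pot_algebra d)
      (vimage_algebra (space (feat_pot_algebra d)) (feat m d) X)"
    by (rule subalgebra_vimage_algebra)
  then show ?thesis
    by (simp add: feat_pot_algebra_def feat_algebra_def)
qed

lemma err_G: "err f l m d \<in> borel_measurable (feat_pot_algebra d)"
proof -
  note l_measurable [measurable] f_measurable [measurable]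
  have "(\<lambda>(y, z). l y z) \<circ> (\<lambda>(x, y). (y, f x)) \<in> borel_measurable (X \<Otimes>\<^sub>M borel)"
    by (rule measurable_comp[OF _ l_measurable]) measurable
  then have h: "(\<lambda>t. l (snd t) (f (fst t))) \<in> borel_measurable (X \<Otimes>\<^sub>M borel)"
    by (simp add: comp_def case_prod_beta')
  have "(\<lambda>\<omega>. (feat m d \<omega>, pot m d \<omega>)) \<in> measurable M (X \<Otimes>\<^sub>M borel)"
    by measurable
  from measurable_compose_vimage_algebra[OF this h] show ?thesis
    by (simp add: feat_pot_algebra_def err_def[abs_def])
qed

lemma err_M [measurable]: "err f l m d \<in> borel_measurable M"
  by (rule measurable_from_subalg[OF MG err_G])

lemma exposed_M [measurable]: "exposed d \<in> sets M"
  unfolding exposed_def by measurable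

text \<open>Unconfoundedness enters here, through the instance in which the exposure lies in
  \<open>{True}\<close>. From this point the results on a single abstract pair are available for
  every pair of the model.\<close>

lemma exposure_pair:
  "exposure M (feat_algebra X m d) (feat_pot_algebra d) (exposed d) (err f l m d)"
proof
  show "AE \<omega> in M. real_cond_exp M (feat_pot_algebra d) (indicator (exposed d)) \<omega>
      = real_cond_exp M (feat_algebra X m d) (indicator (exposed d)) \<omega>"
    unfolding feat_pot_algebra_def feat_algebra_def
  proof (rule cond_exp_indicator_enlarge)
    fix B :: "real set" assume B: "B \<in> sets borel"
    have "{\<omega> \<in> space M. pot m d \<omega> \<in> B} \<inter> exposed d
        = {\<omega> \<in> space M. pot m d \<omega> \<in> B \<and> obs m d \<omega> \<in> {True}}"
      "exposed d = {\<omega> \<in> space M. obs m d \<omega> \<in> {True}}"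
      by (auto simp: exposed_def)
    moreover have "AE \<omega> in M.
        cond_exp_feat X m d (indicator {\<omega> \<in> space M. pot m d \<omega> \<in> B \<and> obs m d \<omega> \<in> {True}}) \<omega> =
        cond_exp_feat X m d (indicator {\<omega> \<in> space M. pot m d \<omega> \<in> B}) \<omega> *
        cond_exp_feat X m d (indicator {\<omega> \<in> space M. obs m d \<omega> \<in> {True}}) \<omega>"
      by (rule unconfounded[OF d, unfolded cond_indep_feat_def, rule_format, OF B]) simp
    ultimately show "AE \<omega> in M.
        real_cond_exp M (vimage_algebra (space M) (feat m d) X)
          (indicator ({\<omega> \<in> space M. pot m d \<omega> \<in> B} \<inter> exposed d)) \<omega> =
        real_cond_exp M (vimage_algebra (space M) (feat m d) X)
          (indicator {\<omega> \<in> space M. pot m d \<omega> \<in> B}) \<omega> *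
        real_cond_exp M (vimage_algebra (space M) (feat m d) X) (indicator (exposed d)) \<omega>"
      by (simp only: cond_exp_feat_def feat_algebra_def)
  qed measurable
qed (rule MG GF err_G err_square_integrable[OF d] exposed_M)+

lemma exposure_quantities:
  shows "exposure.p M (feat_algebra X m d) (exposed d) = propensity X m d"
    and "exposure.g M (feat_algebra X m d) (err f l m d) = err_mean X f l m d"
    and "exposure.s M (feat_algebra X m d) (err f l m d) = err_var X f l m d"
proof -
  interpret exposure M "feat_algebra X m d" "feat_pot_algebra d" "exposed d" "err f l m d"
    by (rule exposure_pair)
  show "p = propensity X m d"
    unfolding p_def by (simp add: propensity_def cond_exp_feat_def exposed_def)
  show g: "g = err_mean X f l m d"
    by (simp add: g_def err_mean_def cond_exp_feat_def)
  show "s = err_var X f l m d"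
    by (simp add: s_def err_var_def cond_exp_feat_def g)
qed

end

text \<open>An average of the terms has the average of the mean errors as its expectation, whereas
  \<open>unbiased\<close> asks for the mean error of each single pair; identical distribution makes
  these agree.\<close>

lemma identical_mean:
  assumes "d \<in> D" "d' \<in> D"
  shows "expectation (err f l m d) = expectation (err f l m d')"
proof -
  let ?h = "\<lambda>t :: 'x \<times> bool \<times> real \<times> real. l (snd (snd (snd t))) (f (fst t))"
  note f_measurable [measurable]
  have "(\<lambda>t. (snd (snd (snd t)), f (fst t))) \<in> measurable (tuple_space X) (borel \<Otimes>\<^sub>M borel)"
    unfolding tuple_space_def by measurable
  from measurable_compose[OF this l_measurable] have h: "?h \<in> borel_measurable (tuple_space X)"
    by simp
  have "expectation (err f l m d) = integral\<^sup>L (distr M (tuple_space X) (tuple m d)) ?h" if "d \<in> D" for d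
    unfolding integral_distr[OF tuple_measurable[OF that] h] by (simp add: tuple_def err_def[abs_def])
  then show ?thesis
    using assms identically_distributed[OF assms] by simp
qed

text \<open>Measurability with respect to the \<open>\<sigma>\<close>-algebras of the tuples is what makes the terms
  \<open>Y d\<close> independent.\<close>

lemma average_moments:
  assumes Y: "\<And>d. d \<in> D \<Longrightarrow> Y d \<in> borel_measurable (tuple_algebra d)"
    and Y2: "\<And>d. d \<in> D \<Longrightarrow> integrable M (\<lambda>\<omega>. (Y d \<omega>)\<^sup>2)"
    and mean: "\<And>d. d \<in> D \<Longrightarrow> expectation (Y d) = expectation (err f l m d)"
    and L: "L \<in> borel_measurable M"
    and L_eq: "AE \<omega> in M. L \<omega> = (\<Sum>d\<in>D. Y d \<omega>) / real (card D)"
  shows "unbiased D f l m L"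
    and "Var m L = (\<Sum>d\<in>D. expectation (\<lambda>\<omega>. (Y d \<omega>)\<^sup>2) - (expectation (err f l m d))\<^sup>2) / (real (card D))\<^sup>2"
proof -
  let ?n = "real (card D)"
  have n: "?n \<noteq> 0"
    using finite_pairs nonempty_pairs by simp
  have YM [measurable]: "Y d \<in> borel_measurable M" if "d \<in> D" for d
    by (rule measurable_from_subalg[OF MT[OF that] Y[OF that]])
  have Yi: "integrable M (Y d)" if "d \<in> D" for d
    by (rule square_integrable_imp_integrable) (use Y2 that in auto)
  have int: "integrable M (\<lambda>\<omega>. (\<Sum>d\<in>D. Y d \<omega>) / ?n)"
    using Yi by simp
  have iL: "integrable M L"
    by (rule integrable_cong_AE_imp[OF int L]) (use L_eq in \<open>eventually_elim, simp\<close>)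
  have EL: "expectation L = (\<Sum>d\<in>D. expectation (Y d)) / ?n"
  proof -
    have "expectation L = expectation (\<lambda>\<omega>. (\<Sum>d\<in>D. Y d \<omega>) / ?n)"
      by (rule integral_cong_AE) (use L L_eq in auto)
    then show ?thesis
      using Yi by simp
  qed
  have EL_err: "expectation L = (\<Sum>d\<in>D. expectation (err f l m d)) / ?n"
    unfolding EL using mean by simp
  have err_int: "integrable M (err f l m d)" if "d \<in> D" for d
    by (rule square_integrable_imp_integrable) (use err_square_integrable that err_M in auto)
  have avg: "(\<Sum>d\<in>D. expectation (err f l m d)) / ?n = expectation (err f l m d')" if "d' \<in> D" for d'
  proof -
    have "(\<Sum>d\<in>D. expectation (err f l m d)) = (\<Sum>d\<in>D. expectation (err f l m d'))"
      by (intro sum.cong refl identical_mean) (use that in auto)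
    then show ?thesis
      using n by simp
  qed
  have "expectation (L_ideal D f l m) = (\<Sum>d\<in>D. expectation (err f l m d)) / ?n"
    unfolding L_ideal_def[abs_def] using err_int by simp
  then show "unbiased D f l m L"
    unfolding unbiased_def using iL EL_err avg by simp
  have "indep_vars (\<lambda>_. borel) Y D"
    by (rule indep_vars_vimage_measurable[OF independent]) (use Y in \<open>simp add: tuple_algebra_def\<close>)
  from variance_sum_indep[OF finite_pairs this Y2]
  have "variance (\<lambda>\<omega>. \<Sum>d\<in>D. Y d \<omega>) = (\<Sum>d\<in>D. variance (Y d))" .
  also have "\<dots> = (\<Sum>d\<in>D. expectation (\<lambda>\<omega>. (Y d \<omega>)\<^sup>2) - (expectation (err f l m d))\<^sup>2)"
    by (intro sum.cong refl, subst variance_eq) (simp_all add: Yi Y2 mean)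
  finally have vs: "variance (\<lambda>\<omega>. \<Sum>d\<in>D. Y d \<omega>) =
      (\<Sum>d\<in>D. expectation (\<lambda>\<omega>. (Y d \<omega>)\<^sup>2) - (expectation (err f l m d))\<^sup>2)" .
  have "Var m L = expectation (\<lambda>\<omega>. ((\<Sum>d\<in>D. Y d \<omega>) - expectation (\<lambda>\<omega>. \<Sum>d\<in>D. Y d \<omega>))\<^sup>2 / ?n\<^sup>2)"
    unfolding Var_def
  proof (rule integral_cong_AE)
    show "AE \<omega> in M. (L \<omega> - expectation L)\<^sup>2
        = ((\<Sum>d\<in>D. Y d \<omega>) - expectation (\<lambda>\<omega>. \<Sum>d\<in>D. Y d \<omega>))\<^sup>2 / ?n\<^sup>2"
      using L_eq
    proof eventually_elim
      case (elim \<omega>)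
      have "expectation L = expectation (\<lambda>\<omega>. \<Sum>d\<in>D. Y d \<omega>) / ?n"
        using EL Yi by simp
      then show ?case
        using elim by (simp add: power_divide flip: diff_divide_distrib)
    qed
  qed (use L in measurable)
  also have "\<dots> = variance (\<lambda>\<omega>. \<Sum>d\<in>D. Y d \<omega>) / ?n\<^sup>2"
    by simp
  finally show "Var m L = (\<Sum>d\<in>D. expectation (\<lambda>\<omega>. (Y d \<omega>)\<^sup>2) - (expectation (err f l m d))\<^sup>2) / ?n\<^sup>2"
    using vs by simp
qed

end

section \<open>Unbiasedness and variances of the three estimators\<close>

context rec_setting
begin

abbreviation "EIB d \<equiv> exposure.eib M (feat_algebra X m d) (exposed d) (err f l m d)"
abbreviation "IPS d \<equiv> exposure.ips M (feat_algebra X m d) (exposed d) (err f l m d)"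
abbreviation "DR d \<equiv> exposure.dr M (feat_algebra X m d) (exposed d) (err f l m d)"

lemma pair_terms:
  assumes d: "d \<in> D" and \<omega>: "\<omega> \<in> space M"
  shows "EIB d \<omega> = of_bool (obs m d \<omega>) * err f l m d \<omega>
          + (1 - of_bool (obs m d \<omega>)) * err_mean X f l m d \<omega>"
    and "IPS d \<omega> = of_bool (obs m d \<omega>) * err f l m d \<omega> / propensity X m d \<omega>"
    and "DR d \<omega> = err_mean X f l m d \<omega>
          + of_bool (obs m d \<omega>) * (err f l m d \<omega> - err_mean X f l m d \<omega>) / propensity X m d \<omega>"
proof -
  interpret exposure M "feat_algebra X m d" "feat_pot_algebra d" "exposed d" "err f l m d"
    by (rule exposure_pair[OF d])
  show "eib \<omega> = of_bool (obs m d \<omega>) * err f l m d \<omega>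
          + (1 - of_bool (obs m d \<omega>)) * err_mean X f l m d \<omega>"
    "ips \<omega> = of_bool (obs m d \<omega>) * err f l m d \<omega> / propensity X m d \<omega>"
    "dr \<omega> = err_mean X f l m d \<omega>
          + of_bool (obs m d \<omega>) * (err f l m d \<omega> - err_mean X f l m d \<omega>) / propensity X m d \<omega>"
    unfolding eib_def ips_def dr_def exposure_quantities[OF d]
    using \<omega> by (auto simp: exposed_def indicator_def)
qed

lemma pair_terms_T:
  assumes d: "d \<in> D"
  shows "EIB d \<in> borel_measurable (tuple_algebra d)"
    and "IPS d \<in> borel_measurable (tuple_algebra d)"
    and "DR d \<in> borel_measurable (tuple_algebra d)"
proof -
  interpret exposure M "feat_algebra X m d" "feat_pot_algebra d" "exposed d" "err f l m d"
    by (rule exposure_pair[OF d])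
  note GT = measurable_from_subalg[OF feat_pot_algebra_le_tuple_algebra[OF d]]
  note [measurable] = GT[OF e_G] GT[OF p_G] GT[OF g_G] obs_T[OF d]
  have "exposed d = {\<omega> \<in> space (tuple_algebra d). obs m d \<omega>}"
    by (simp add: exposed_def tuple_algebra_def)
  also have "\<dots> \<in> sets (tuple_algebra d)"
    by measurable
  finally have [measurable]: "exposed d \<in> sets (tuple_algebra d)" .
  show "eib \<in> borel_measurable (tuple_algebra d)" "ips \<in> borel_measurable (tuple_algebra d)"
    "dr \<in> borel_measurable (tuple_algebra d)"
    unfolding eib_def[abs_def] ips_def[abs_def] dr_def[abs_def] by measurable
qed

lemma estimators_M:
  shows "L_EIB D f l m \<in> borel_measurable M" "L_IPS D f l m \<in> borel_measurable M"
    "L_DR D f l m \<in> borel_measurable M"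
proof -
  note [measurable] = prop_hat_measurable err_hat_measurable err_M obs_M
  show "L_EIB D f l m \<in> borel_measurable M" "L_IPS D f l m \<in> borel_measurable M"
    "L_DR D f l m \<in> borel_measurable M"
    unfolding L_EIB_def[abs_def] L_IPS_def[abs_def] L_DR_def[abs_def] of_bool_def by measurable
qed

lemma card_square_pos: "0 < (real (card D))\<^sup>2"
  using finite_pairs nonempty_pairs by (simp add: card_gt_0_iff)

context
  assumes imp: "accurate_imputation D X f l m"
begin

text \<open>Only accurate imputation is assumed, since \<open>EIB_variances\<close> ranges over
  models whose learned propensity may be inaccurate and whose propensity may be 0.\<close>

lemma
  shows EIB_unbiased: "unbiased D f l m (L_EIB D f l m)"
    and EIB_Var: "Var m (L_EIB D f l m) =
      (\<Sum>d\<in>D. expectation (\<lambda>\<omega>. (EIB d \<omega>)\<^sup>2) - (expectation (err f l m d))\<^sup>2) / (real (card D))\<^sup>2"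
proof -
  have 1: "integrable M (\<lambda>\<omega>. (EIB d \<omega>)\<^sup>2)" "expectation (EIB d) = expectation (err f l m d)"
    if "d \<in> D" for d
    using exposure.eib_square_integrable exposure.integral_eib exposure_pair[OF that] by blast+
  have "AE \<omega> in M. \<forall>d\<in>D. err_hat m d \<omega> = err_mean X f l m d \<omega>"
    using imp finite_pairs by (simp add: AE_finite_all accurate_imputation_def)
  then have "AE \<omega> in M. L_EIB D f l m \<omega> = (\<Sum>d\<in>D. EIB d \<omega>) / real (card D)"
    using AE_space by eventually_elim (simp add: L_EIB_def pair_terms)
  note * = average_moments[OF pair_terms_T(1) 1 estimators_M(1) this]
  show "unbiased D f l m (L_EIB D f l m)"
    and "Var m (L_EIB D f l m) =
      (\<Sum>d\<in>D. expectation (\<lambda>\<omega>. (EIB d \<omega>)\<^sup>2) - (expectation (err f l m d))\<^sup>2) / (real (card D))\<^sup>2"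
    using * by simp_all
qed

context
  assumes prop_acc: "accurate_propensity D X m" and ips_sq: "ips_square_integrable D f l m"
begin

text \<open>Positivity is inherited from the learned propensity, which is positive everywhere and
  accurate almost surely.\<close>

lemma propensity_pos: "d \<in> D \<Longrightarrow> AE \<omega> in M. 0 < propensity X m d \<omega>"
proof -
  assume d: "d \<in> D"
  then have "AE \<omega> in M. prop_hat m d \<omega> = propensity X m d \<omega>"
    using prop_acc by (simp add: accurate_propensity_def)
  then show "AE \<omega> in M. 0 < propensity X m d \<omega>"
    using AE_space by eventually_elim (metis prop_hat_range[OF d])
qed

lemma IPS_square_integrable:
  assumes d: "d \<in> D"
  shows "integrable M (\<lambda>\<omega>. (IPS d \<omega>)\<^sup>2)"
proof -
  interpret exposure M "feat_algebra X m d" "feat_pot_algebra d" "exposed d" "err f l m d"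
    by (rule exposure_pair[OF d])
  have i: "integrable M (\<lambda>\<omega>. (of_bool (obs m d \<omega>) * err f l m d \<omega> / prop_hat m d \<omega>)\<^sup>2)"
    using ips_sq d by (simp add: ips_square_integrable_def)
  have "AE \<omega> in M. prop_hat m d \<omega> = propensity X m d \<omega>"
    using prop_acc d by (simp add: accurate_propensity_def)
  then have "AE \<omega> in M. (of_bool (obs m d \<omega>) * err f l m d \<omega> / prop_hat m d \<omega>)\<^sup>2 = (IPS d \<omega>)\<^sup>2"
    using AE_space by eventually_elim (simp add: pair_terms[OF d])
  then show ?thesis
    by (intro integrable_cong_AE_imp[OF i]) (auto intro: AE_symmetric)
qed

lemma pair_facts:
  assumes d: "d \<in> D"
  shows "AE \<omega> in M. 0 < exposure.p M (feat_algebra X m d) (exposed d) \<omega>"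
    and "integrable M (\<lambda>\<omega>. (IPS d \<omega>)\<^sup>2)"
  using propensity_pos[OF d] IPS_square_integrable[OF d] exposure_quantities[OF d] by simp_all

lemma
  shows IPS_unbiased: "unbiased D f l m (L_IPS D f l m)"
    and IPS_Var: "Var m (L_IPS D f l m) =
      (\<Sum>d\<in>D. expectation (\<lambda>\<omega>. (IPS d \<omega>)\<^sup>2) - (expectation (err f l m d))\<^sup>2) / (real (card D))\<^sup>2"
proof -
  have 1: "expectation (IPS d) = expectation (err f l m d)" if "d \<in> D" for d
    by (rule exposure.integral_ips[OF exposure_pair pair_facts]) (use that in auto)
  have "AE \<omega> in M. \<forall>d\<in>D. prop_hat m d \<omega> = propensity X m d \<omega>"
    using prop_acc finite_pairs by (simp add: AE_finite_all accurate_propensity_def)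
  then have "AE \<omega> in M. L_IPS D f l m \<omega> = (\<Sum>d\<in>D. IPS d \<omega>) / real (card D)"
    using AE_space by eventually_elim (simp add: L_IPS_def pair_terms)
  note * = average_moments[OF pair_terms_T(2) IPS_square_integrable 1 estimators_M(2) this]
  show "unbiased D f l m (L_IPS D f l m)"
    and "Var m (L_IPS D f l m) =
      (\<Sum>d\<in>D. expectation (\<lambda>\<omega>. (IPS d \<omega>)\<^sup>2) - (expectation (err f l m d))\<^sup>2) / (real (card D))\<^sup>2"
    using * by simp_all
qed

lemma
  shows DR_unbiased: "unbiased D f l m (L_DR D f l m)"
    and DR_Var: "Var m (L_DR D f l m) =
      (\<Sum>d\<in>D. expectation (\<lambda>\<omega>. (DR d \<omega>)\<^sup>2) - (expectation (err f l m d))\<^sup>2) / (real (card D))\<^sup>2"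
proof -
  have 1: "integrable M (\<lambda>\<omega>. (DR d \<omega>)\<^sup>2)" if "d \<in> D" for d
    by (rule exposure.dr_square_integrable[OF exposure_pair pair_facts]) (use that in auto)
  have 2: "expectation (DR d) = expectation (err f l m d)" if "d \<in> D" for d
    by (rule exposure.integral_dr[OF exposure_pair pair_facts]) (use that in auto)
  have "AE \<omega> in M. \<forall>d\<in>D. prop_hat m d \<omega> = propensity X m d \<omega>"
    "AE \<omega> in M. \<forall>d\<in>D. err_hat m d \<omega> = err_mean X f l m d \<omega>"
    using prop_acc imp finite_pairs
    by (simp_all add: AE_finite_all accurate_propensity_def accurate_imputation_def)
  then have "AE \<omega> in M. L_DR D f l m \<omega> = (\<Sum>d\<in>D. DR d \<omega>) / real (card D)"
    using AE_space by eventually_elim (simp add: L_DR_def pair_terms)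
  note * = average_moments[OF pair_terms_T(3) 1 2 estimators_M(3) this]
  show "unbiased D f l m (L_DR D f l m)"
    and "Var m (L_DR D f l m) =
      (\<Sum>d\<in>D. expectation (\<lambda>\<omega>. (DR d \<omega>)\<^sup>2) - (expectation (err f l m d))\<^sup>2) / (real (card D))\<^sup>2"
    using * by simp_all
qed

section \<open>Order of the variances and the cases of equality\<close>

lemma Var_EIB_le_DR: "Var m (L_EIB D f l m) \<le> Var m (L_DR D f l m)"
  unfolding EIB_Var DR_Var
  by (intro divide_right_mono sum_mono diff_right_mono exposure.eib_le_dr[OF exposure_pair pair_facts])
     simp_all

lemma Var_DR_le_IPS: "Var m (L_DR D f l m) \<le> Var m (L_IPS D f l m)"
  unfolding IPS_Var DR_Var
  by (intro divide_right_mono sum_mono diff_right_mono exposure.dr_le_ips[OF exposure_pair pair_facts])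
     simp_all

text \<open>The contributions are ordered pair by pair, so equality of the finite sums forces
  equality for every pair, where the single-pair criterion applies.\<close>

lemma Var_EIB_eq_DR_iff:
  "Var m (L_EIB D f l m) = Var m (L_DR D f l m) \<longleftrightarrow>
    (\<forall>d\<in>D. AE \<omega> in M. propensity X m d \<omega> = 1 \<or> err_var X f l m d \<omega> = 0)"
proof -
  have le: "expectation (\<lambda>\<omega>. (EIB d \<omega>)\<^sup>2) - (expectation (err f l m d))\<^sup>2
      \<le> expectation (\<lambda>\<omega>. (DR d \<omega>)\<^sup>2) - (expectation (err f l m d))\<^sup>2" if "d \<in> D" for d
    using exposure.eib_le_dr[OF exposure_pair pair_facts, OF that that that] by simp
  have "Var m (L_EIB D f l m) = Var m (L_DR D f l m) \<longleftrightarrow>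
      (\<forall>d\<in>D. expectation (\<lambda>\<omega>. (EIB d \<omega>)\<^sup>2) = expectation (\<lambda>\<omega>. (DR d \<omega>)\<^sup>2))" (is "?l \<longleftrightarrow> ?r")
  proof
    assume ?l
    then have "(\<Sum>d\<in>D. expectation (\<lambda>\<omega>. (EIB d \<omega>)\<^sup>2) - (expectation (err f l m d))\<^sup>2)
        = (\<Sum>d\<in>D. expectation (\<lambda>\<omega>. (DR d \<omega>)\<^sup>2) - (expectation (err f l m d))\<^sup>2)"
      using card_square_pos by (simp add: EIB_Var DR_Var)
    from sum_mono_inv[OF this le _ finite_pairs] show ?r
      by auto
  qed (simp add: EIB_Var DR_Var)
  also have "\<dots> \<longleftrightarrow> (\<forall>d\<in>D. AE \<omega> in M. propensity X m d \<omega> = 1 \<or> err_var X f l m d \<omega> = 0)"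
    by (intro ball_cong refl)
       (simp add: exposure.eib_eq_dr_iff[OF exposure_pair pair_facts] exposure_quantities)
  finally show ?thesis .
qed

lemma Var_DR_eq_IPS_iff:
  "Var m (L_DR D f l m) = Var m (L_IPS D f l m) \<longleftrightarrow>
    (\<forall>d\<in>D. AE \<omega> in M. propensity X m d \<omega> = 1 \<or> err_mean X f l m d \<omega> = 0)"
proof -
  have le: "expectation (\<lambda>\<omega>. (DR d \<omega>)\<^sup>2) - (expectation (err f l m d))\<^sup>2
      \<le> expectation (\<lambda>\<omega>. (IPS d \<omega>)\<^sup>2) - (expectation (err f l m d))\<^sup>2" if "d \<in> D" for d
    using exposure.dr_le_ips[OF exposure_pair pair_facts, OF that that that] by simp
  have "Var m (L_DR D f l m) = Var m (L_IPS D f l m) \<longleftrightarrow>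
      (\<forall>d\<in>D. expectation (\<lambda>\<omega>. (DR d \<omega>)\<^sup>2) = expectation (\<lambda>\<omega>. (IPS d \<omega>)\<^sup>2))" (is "?l \<longleftrightarrow> ?r")
  proof
    assume ?l
    then have "(\<Sum>d\<in>D. expectation (\<lambda>\<omega>. (DR d \<omega>)\<^sup>2) - (expectation (err f l m d))\<^sup>2)
        = (\<Sum>d\<in>D. expectation (\<lambda>\<omega>. (IPS d \<omega>)\<^sup>2) - (expectation (err f l m d))\<^sup>2)"
      using card_square_pos by (simp add: IPS_Var DR_Var)
    from sum_mono_inv[OF this le _ finite_pairs] show ?r
      by auto
  qed (simp add: IPS_Var DR_Var)
  also have "\<dots> \<longleftrightarrow> (\<forall>d\<in>D. AE \<omega> in M. propensity X m d \<omega> = 1 \<or> err_mean X f l m d \<omega> = 0)"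
    by (intro ball_cong refl)
       (simp add: exposure.dr_eq_ips_iff[OF exposure_pair pair_facts] exposure_quantities)
  finally show ?thesis .
qed

lemma pair_second_moments:
  assumes d: "d \<in> D"
  shows "expectation (\<lambda>\<omega>. (IPS d \<omega>)\<^sup>2) = expectation (\<lambda>\<omega>. (err f l m d \<omega>)\<^sup>2 / propensity X m d \<omega>)"
    and "integrable M (\<lambda>\<omega>. (err f l m d \<omega>)\<^sup>2 / propensity X m d \<omega>)"
    and "expectation (\<lambda>\<omega>. (DR d \<omega>)\<^sup>2) = expectation (\<lambda>\<omega>. (err_mean X f l m d \<omega>)\<^sup>2)
        + expectation (\<lambda>\<omega>. (err f l m d \<omega> - err_mean X f l m d \<omega>)\<^sup>2 / propensity X m d \<omega>)"
    and "integrable M (\<lambda>\<omega>. (err f l m d \<omega> - err_mean X f l m d \<omega>)\<^sup>2 / propensity X m d \<omega>)"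
  using exposure.ips_second_moment[OF exposure_pair pair_facts, OF d d d]
    exposure.e2_over_p[OF exposure_pair pair_facts, OF d d d]
    exposure.dr_second_moment[OF exposure_pair pair_facts, OF d d d]
    exposure.r2_over_p[OF exposure_pair pair_facts, OF d d d]
  by (simp_all only: exposure_quantities[OF d])

text \<open>The mean of the IPS term is the mean error, so this difference is the variance of that
  term.\<close>

lemma IPS_term_nonneg:
  assumes d: "d \<in> D"
  shows "0 \<le> expectation (\<lambda>\<omega>. (IPS d \<omega>)\<^sup>2) - (expectation (err f l m d))\<^sup>2"
  using square_mean_le[OF exposure.ips_M[OF exposure_pair] IPS_square_integrable, OF d d]
    exposure.integral_ips[OF exposure_pair pair_facts, OF d d d] by simp

lemma DR_term_nonneg:
  assumes d: "d \<in> D"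
  shows "0 \<le> expectation (\<lambda>\<omega>. (DR d \<omega>)\<^sup>2) - (expectation (err f l m d))\<^sup>2"
  using square_mean_le[OF exposure.dr_M[OF exposure_pair]
      exposure.dr_square_integrable[OF exposure_pair pair_facts], OF d d d d]
    exposure.integral_dr[OF exposure_pair pair_facts, OF d d d] by simp

end

end

end

section \<open>Conditional mean as a function of the feature, and the model without exposure\<close>

context rec_setting
begin

lemma feat_err_M:
  "d \<in> D \<Longrightarrow> (\<lambda>\<omega>. (feat m d \<omega>, err f l m d \<omega>)) \<in> measurable M (X \<Otimes>\<^sub>M borel)"
  using feat_M err_M by measurable

lemma err_mean_factor:
  assumes d: "d \<in> D"
  obtains h where "h \<in> borel_measurable X" "\<And>\<omega>. \<omega> \<in> space M \<Longrightarrow> err_mean X f l m d \<omega> = h (feat m d \<omega>)"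
proof (rule factor_through_vimage_algebra)
  show "feat m d \<in> space M \<rightarrow> space X"
    using measurable_space[OF feat_M[OF d]] by (rule funcsetI)
  show "err_mean X f l m d \<in> borel_measurable (vimage_algebra (space M) (feat m d) X)"
    by (simp add: err_mean_def cond_exp_feat_def feat_algebra_def)
qed (rule that)

lemma
  assumes d: "d \<in> D"
  shows err_mean_M: "err_mean X f l m d \<in> borel_measurable M"
    and propensity_M: "propensity X m d \<in> borel_measurable M"
    and err_integrable: "integrable M (err f l m d)"
    and err_mean_integrable: "integrable M (err_mean X f l m d)"
    and residual_square_integrable: "integrable M (\<lambda>\<omega>. (err f l m d \<omega> - err_mean X f l m d \<omega>)\<^sup>2)"
    and propensity_range: "AE \<omega> in M. 0 \<le> propensity X m d \<omega> \<and> propensity X m d \<omega> \<le> 1"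
    and EIB_second_moment: "expectation (\<lambda>\<omega>. (EIB d \<omega>)\<^sup>2) = expectation (\<lambda>\<omega>. (err_mean X f l m d \<omega>)\<^sup>2)
        + expectation (\<lambda>\<omega>. propensity X m d \<omega> * (err f l m d \<omega> - err_mean X f l m d \<omega>)\<^sup>2)"
    and second_moment_split: "AE \<omega> in M. cond_exp_feat X m d (\<lambda>\<omega>. (err f l m d \<omega>)\<^sup>2) \<omega>
        = err_var X f l m d \<omega> + (err_mean X f l m d \<omega>)\<^sup>2"
    and residual_zero: "AE \<omega> in M. (err f l m d \<omega> - err_mean X f l m d \<omega>)\<^sup>2 = 0 \<Longrightarrow>
        AE \<omega> in M. err_var X f l m d \<omega> = 0"
proof -
  interpret exposure M "feat_algebra X m d" "feat_pot_algebra d" "exposed d" "err f l m d"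
    by (rule exposure_pair[OF d])
  note * = g_M p_M e_integrable g_integrable r2 p_range eib_second_moment
    second_moment_decomposition residual_zero_imp_s_zero
  note * = *[unfolded exposure_quantities[OF d]]
  show "err_mean X f l m d \<in> borel_measurable M" "propensity X m d \<in> borel_measurable M"
    "integrable M (err f l m d)" "integrable M (err_mean X f l m d)"
    "integrable M (\<lambda>\<omega>. (err f l m d \<omega> - err_mean X f l m d \<omega>)\<^sup>2)"
    "AE \<omega> in M. 0 \<le> propensity X m d \<omega> \<and> propensity X m d \<omega> \<le> 1"
    "expectation (\<lambda>\<omega>. (EIB d \<omega>)\<^sup>2) = expectation (\<lambda>\<omega>. (err_mean X f l m d \<omega>)\<^sup>2)
        + expectation (\<lambda>\<omega>. propensity X m d \<omega> * (err f l m d \<omega> - err_mean X f l m d \<omega>)\<^sup>2)"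
    by (fact *)+
  show "AE \<omega> in M. cond_exp_feat X m d (\<lambda>\<omega>. (err f l m d \<omega>)\<^sup>2) \<omega>
        = err_var X f l m d \<omega> + (err_mean X f l m d \<omega>)\<^sup>2"
    unfolding cond_exp_feat_def by (fact *)
  show "AE \<omega> in M. err_var X f l m d \<omega> = 0"
    if "AE \<omega> in M. (err f l m d \<omega> - err_mean X f l m d \<omega>)\<^sup>2 = 0"
    using that by (fact *)
qed

abbreviation unexposed :: "('a, 'x, 'd) rec_model" where
  "unexposed \<equiv> m\<lparr>obs := \<lambda>_ _. False\<rparr>"

lemma pspace_unexposed: "pspace unexposed = M"
  by simp

lemma err_unexposed: "err f l unexposed = err f l m"
  by (simp add: err_def fun_eq_iff)

lemma cond_exp_feat_unexposed: "cond_exp_feat X unexposed = cond_exp_feat X m"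
  by (simp add: cond_exp_feat_def feat_algebra_def fun_eq_iff)

lemma err_mean_unexposed: "err_mean X f l unexposed = err_mean X f l m"
  by (simp add: err_mean_def cond_exp_feat_unexposed err_unexposed fun_eq_iff)

lemma cond_exp_feat_const:
  assumes d: "d \<in> D"
  shows "AE \<omega> in M. cond_exp_feat X m d (indicator {}) \<omega> = (0 :: real)"
    and "AE \<omega> in M. cond_exp_feat X m d (indicator (space M)) \<omega> = (1 :: real)"
proof -
  interpret exposure M "feat_algebra X m d" "feat_pot_algebra d" "exposed d" "err f l m d"
    by (rule exposure_pair[OF d])
  have sp: "space M \<in> sets (feat_algebra X m d)"
    using sets.top[of "feat_algebra X m d"] by (simp add: feat_algebra_def)
  have "AE \<omega> in M. cond_exp_feat X m d (indicator {}) \<omega> = indicator {} \<omega>"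
    unfolding cond_exp_feat_def by (rule F.real_cond_exp_F_meas) auto
  then show "AE \<omega> in M. cond_exp_feat X m d (indicator {}) \<omega> = (0 :: real)"
    by simp
  have "AE \<omega> in M. cond_exp_feat X m d (indicator (space M)) \<omega> = indicator (space M) \<omega>"
    unfolding cond_exp_feat_def
    by (rule F.real_cond_exp_F_meas)
       (simp_all add: integrable_indicator_iff emeasure_eq_measure sp borel_measurable_indicator)
  then show "AE \<omega> in M. cond_exp_feat X m d (indicator (space M)) \<omega> = (1 :: real)"
    using AE_space by eventually_elim simp
qed

lemma propensity_unexposed:
  assumes d: "d \<in> D"
  shows "AE \<omega> in M. propensity X unexposed d \<omega> = 0"
proof -
  have "propensity X unexposed d = cond_exp_feat X m d (indicator {})"
    by (simp add: propensity_def cond_exp_feat_unexposed)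
  then show ?thesis
    using cond_exp_feat_const(1)[OF d] by simp
qed

text \<open>A constant exposure is conditionally independent of everything, consistency becomes
  vacuous, and the new tuple is a measurable image of the old one, so it stays independent and
  identically distributed. The learned propensity keeps its positive values although the true
  propensity is now 0.\<close>

lemma rec_setting_unexposed: "rec_setting unexposed D X f l"
proof -
  let ?c = "\<lambda>t :: 'x \<times> bool \<times> real \<times> real. (fst t, False, fst (snd (snd t)), snd (snd (snd t)))"
  have c: "?c \<in> measurable (tuple_space X) (tuple_space X)"
    unfolding tuple_space_def by measurable
  have tuple_c: "tuple unexposed d = (\<lambda>\<omega>. ?c (tuple m d \<omega>))" for d
    by (simp add: tuple_def fun_eq_iff)
  show ?thesis
  proof (intro rec_setting.intro rec_setting_axioms.intro)
    show "prob_space (pspace unexposed)"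
      using prob_space_axioms by simp
    show "tuple unexposed d \<in> measurable (pspace unexposed) (tuple_space X)" if "d \<in> D" for d
      unfolding tuple_c using measurable_compose[OF tuple_measurable[OF that] c] by simp
    have "indep_vars (\<lambda>_. tuple_space X) (tuple unexposed) D"
      unfolding tuple_c[abs_def] by (rule indep_vars_compose2[OF independent]) (rule c)
    then show "prob_space.indep_vars (pspace unexposed) (\<lambda>_. tuple_space X) (tuple unexposed) D"
      by simp
    show "distr (pspace unexposed) (tuple_space X) (tuple unexposed d)
        = distr (pspace unexposed) (tuple_space X) (tuple unexposed d')" if "d \<in> D" "d' \<in> D" for d d'
    proof -
      have "distr M (tuple_space X) (tuple unexposed d)
          = distr (distr M (tuple_space X) (tuple m d)) (tuple_space X) ?c" if "d \<in> D" for d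
        unfolding tuple_c by (subst distr_distr[OF c tuple_measurable[OF that]]) (simp add: comp_def)
      then show ?thesis
        using identically_distributed[OF that] that by simp
    qed
    show "cond_indep_feat X unexposed d borel (pot unexposed d) (count_space UNIV) (obs unexposed d)"
      if d: "d \<in> D" for d
      unfolding cond_indep_feat_def
    proof (intro ballI)
      fix A :: "real set" and B :: "bool set"
      \<comment> \<open>With exposure constantly \<open>False\<close>, the second event is the whole
        space or empty, according to whether \<open>B\<close> contains \<open>False\<close>.\<close>
      show "AE \<omega> in pspace unexposed.
        cond_exp_feat X unexposed d
          (indicator {\<omega> \<in> space (pspace unexposed). pot unexposed d \<omega> \<in> A \<and> obs unexposed d \<omega> \<in> B}) \<omega> =
        cond_exp_feat X unexposed d (indicator {\<omega> \<in> space (pspace unexposed). pot unexposed d \<omega> \<in> A}) \<omega> *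
        cond_exp_feat X unexposed d (indicator {\<omega> \<in> space (pspace unexposed). obs unexposed d \<omega> \<in> B}) \<omega>"
      proof (cases "False \<in> B")
        case True
        from cond_exp_feat_const(2)[OF d]
        have "AE \<omega> in M. cond_exp_feat X m d (indicator {\<omega> \<in> space M. pot m d \<omega> \<in> A}) \<omega> =
            cond_exp_feat X m d (indicator {\<omega> \<in> space M. pot m d \<omega> \<in> A}) \<omega> *
            cond_exp_feat X m d (indicator (space M)) \<omega>"
          by eventually_elim simp
        with True show ?thesis
          unfolding pspace_unexposed by (simp add: cond_exp_feat_unexposed)
      next
        case False
        from cond_exp_feat_const(1)[OF d]
        have "AE \<omega> in M. cond_exp_feat X m d (indicator {}) \<omega> =
            cond_exp_feat X m d (indicator {\<omega> \<in> space M. pot m d \<omega> \<in> A}) \<omega> *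
            cond_exp_feat X m d (indicator {}) \<omega>"
          by eventually_elim simp
        with False show ?thesis
          unfolding pspace_unexposed by (simp add: cond_exp_feat_unexposed)
      qed
    qed
    show "integrable (pspace unexposed) (\<lambda>\<omega>. (err f l unexposed d \<omega>)\<^sup>2)" if "d \<in> D" for d
      unfolding err_unexposed using err_square_integrable[OF that] by simp
  qed (use finite_pairs nonempty_pairs f_measurable l_measurable prop_hat_measurable
      err_hat_measurable prop_hat_range in simp_all)
qed

end

section \<open>Varying the propensity\<close>

text \<open>The two models may have different measures and unrelated exposure mechanisms. Their only
  link is the joint law of feature and error of each pair, so each quantity of \<open>m'\<close> has
  to be expressed through that law before it can be compared with \<open>m\<close>.\<close>

locale matched_settings = rec_setting m D X f l + other: rec_setting m' D X f l
  for m m' :: "('a, 'x, 'd) rec_model" and D X f l +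
  assumes same_law: "same_feat_err_law D X f l m m'"
begin

context
  fixes d assumes d: "d \<in> D"
begin

lemma law_eq:
  "distr (pspace m') (X \<Otimes>\<^sub>M borel) (\<lambda>\<omega>. (feat m' d \<omega>, err f l m' d \<omega>)) =
   distr M (X \<Otimes>\<^sub>M borel) (\<lambda>\<omega>. (feat m d \<omega>, err f l m d \<omega>))"
  using same_law d by (simp add: same_feat_err_law_def)

lemma integral_transfer:
  fixes \<psi> :: "'x \<Rightarrow> real \<Rightarrow> real"
  assumes "(\<lambda>t. \<psi> (fst t) (snd t)) \<in> borel_measurable (X \<Otimes>\<^sub>M borel)"
  shows "(\<integral>\<omega>. \<psi> (feat m' d \<omega>) (err f l m' d \<omega>) \<partial>pspace m') = (\<integral>\<omega>. \<psi> (feat m d \<omega>) (err f l m d \<omega>) \<partial>M)"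
  using integral_distr[OF feat_err_M[OF d] assms] integral_distr[OF other.feat_err_M[OF d] assms] law_eq
  by simp

lemma integrable_transfer:
  fixes \<psi> :: "'x \<Rightarrow> real \<Rightarrow> real"
  assumes "(\<lambda>t. \<psi> (fst t) (snd t)) \<in> borel_measurable (X \<Otimes>\<^sub>M borel)"
  shows "integrable (pspace m') (\<lambda>\<omega>. \<psi> (feat m' d \<omega>) (err f l m' d \<omega>)) \<longleftrightarrow>
    integrable M (\<lambda>\<omega>. \<psi> (feat m d \<omega>) (err f l m d \<omega>))"
  using integrable_distr_eq[OF feat_err_M[OF d] assms]
    integrable_distr_eq[OF other.feat_err_M[OF d] assms] law_eq
  by simp

lemma AE_transfer:
  assumes P: "{\<xi> \<in> space X. P \<xi>} \<in> sets X"
  shows "(AE \<omega> in pspace m'. P (feat m' d \<omega>)) \<longleftrightarrow> (AE \<omega> in M. P (feat m d \<omega>))"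
proof -
  have "{t \<in> space (X \<Otimes>\<^sub>M (borel :: real measure)). P (fst t)} = {\<xi> \<in> space X. P \<xi>} \<times> UNIV"
    by (auto simp: space_pair_measure)
  also have "\<dots> \<in> sets (X \<Otimes>\<^sub>M borel)"
    using P by simp
  finally have "{t \<in> space (X \<Otimes>\<^sub>M (borel :: real measure)). P (fst t)} \<in> sets (X \<Otimes>\<^sub>M borel)" .
  from AE_distr_iff[OF feat_err_M[OF d] this]
    AE_distr_iff[OF other.feat_err_M[OF d] this, unfolded law_eq]
  show ?thesis
    by simp
qed

lemma mean_transfer: "other.expectation (err f l m' d) = expectation (err f l m d)"
  by (rule integral_transfer) measurable

text \<open>A conditional mean given the feature is characterized by its integrals over the events
  that the feature lies in \<open>B\<close>. These depend only on the joint law of feature and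
  error, so a single \<open>h\<close> represents the conditional mean in both models.\<close>

lemma err_mean_transfer:
  assumes h [measurable]: "h \<in> borel_measurable X"
    and g: "\<And>\<omega>. \<omega> \<in> space M \<Longrightarrow> err_mean X f l m d \<omega> = h (feat m d \<omega>)"
  shows "AE \<omega> in pspace m'. err_mean X f l m' d \<omega> = h (feat m' d \<omega>)"
proof -
  interpret e: exposure M "feat_algebra X m d" "feat_pot_algebra d" "exposed d" "err f l m d"
    by (rule exposure_pair[OF d])
  interpret e': exposure "pspace m'" "feat_algebra X m' d" "other.feat_pot_algebra d"
      "other.exposed d" "err f l m' d"
    by (rule other.exposure_pair[OF d])
  have ih: "integrable M (\<lambda>\<omega>. h (feat m d \<omega>))"
    by (rule Bochner_Integration.integrable_cong[THEN iffD1, OF refl _ err_mean_integrable[OF d]]) (rule g)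
  note feat_M [OF d, measurable] other.feat_M [OF d, measurable]
  show ?thesis
    unfolding err_mean_def cond_exp_feat_def
  proof (rule e'.F.real_cond_exp_charact)
    fix A assume "A \<in> sets (feat_algebra X m' d)"
    moreover have "feat m' d \<in> space (pspace m') \<rightarrow> space X"
      using measurable_space[OF other.feat_M[OF d]] by (rule funcsetI)
    ultimately obtain B where B [measurable]: "B \<in> sets X"
      and A: "A = feat m' d -` B \<inter> space (pspace m')"
      unfolding feat_algebra_def by (auto simp: sets_vimage_algebra2)
    let ?A = "feat m d -` B \<inter> space M"
    have A0: "?A \<in> sets (feat_algebra X m d)"
      unfolding feat_algebra_def by (rule in_vimage_algebra[OF B])
    have "set_lebesgue_integral (pspace m') A (err f l m' d)
        = (\<integral>\<omega>. indicator B (feat m' d \<omega>) * err f l m' d \<omega> \<partial>pspace m')"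
      unfolding set_lebesgue_integral_def A
      by (intro Bochner_Integration.integral_cong refl) (auto simp: indicator_def)
    also have "\<dots> = (\<integral>\<omega>. indicator B (feat m d \<omega>) * err f l m d \<omega> \<partial>M)"
      by (rule integral_transfer) measurable
    also have "\<dots> = set_lebesgue_integral M ?A (err f l m d)"
      unfolding set_lebesgue_integral_def
      by (intro Bochner_Integration.integral_cong refl) (auto simp: indicator_def)
    also have "\<dots> = set_lebesgue_integral M ?A (err_mean X f l m d)"
      unfolding err_mean_def cond_exp_feat_def
      by (rule e.F.real_cond_exp_intA[OF err_integrable[OF d] A0])
    also have "\<dots> = (\<integral>\<omega>. indicator B (feat m d \<omega>) * h (feat m d \<omega>) \<partial>M)"
      unfolding set_lebesgue_integral_def
      by (intro Bochner_Integration.integral_cong refl) (auto simp: indicator_def g)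
    also have "\<dots> = (\<integral>\<omega>. indicator B (feat m' d \<omega>) * h (feat m' d \<omega>) \<partial>pspace m')"
      by (rule integral_transfer[symmetric, of "\<lambda>x _. indicator B x * h x"]) measurable
    also have "\<dots> = set_lebesgue_integral (pspace m') A (\<lambda>\<omega>. h (feat m' d \<omega>))"
      unfolding set_lebesgue_integral_def A
      by (intro Bochner_Integration.integral_cong refl) (auto simp: indicator_def)
    finally show "set_lebesgue_integral (pspace m') A (err f l m' d)
        = set_lebesgue_integral (pspace m') A (\<lambda>\<omega>. h (feat m' d \<omega>))" .
  next
    show "integrable (pspace m') (err f l m' d)"
      by (rule other.err_integrable[OF d])
    show "integrable (pspace m') (\<lambda>\<omega>. h (feat m' d \<omega>))"
      by (subst integrable_transfer[of "\<lambda>x _. h x"]) (measurable, rule ih)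
    show "(\<lambda>\<omega>. h (feat m' d \<omega>)) \<in> borel_measurable (feat_algebra X m' d)"
      unfolding feat_algebra_def
      by (rule measurable_compose_vimage_algebra[OF other.feat_M[OF d] h])
  qed
qed

lemma err_mean_square_transfer:
  "other.expectation (\<lambda>\<omega>. (err_mean X f l m' d \<omega>)\<^sup>2) = expectation (\<lambda>\<omega>. (err_mean X f l m d \<omega>)\<^sup>2)"
proof -
  obtain h where h [measurable]: "h \<in> borel_measurable X"
    and g: "\<And>\<omega>. \<omega> \<in> space M \<Longrightarrow> err_mean X f l m d \<omega> = h (feat m d \<omega>)"
    using err_mean_factor[OF d] by metis
  note other.feat_M [OF d, measurable] other.err_mean_M [OF d, measurable]
  have "other.expectation (\<lambda>\<omega>. (err_mean X f l m' d \<omega>)\<^sup>2)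
      = other.expectation (\<lambda>\<omega>. (h (feat m' d \<omega>))\<^sup>2)"
    by (rule integral_cong_AE) (use err_mean_transfer[OF h g] in auto)
  also have "\<dots> = expectation (\<lambda>\<omega>. (h (feat m d \<omega>))\<^sup>2)"
    by (rule integral_transfer[of "\<lambda>x _. (h x)\<^sup>2"]) measurable
  also have "\<dots> = expectation (\<lambda>\<omega>. (err_mean X f l m d \<omega>)\<^sup>2)"
    by (intro Bochner_Integration.integral_cong refl) (simp add: g)
  finally show ?thesis .
qed

context
  fixes q assumes q: "propensity_function X m' d q"
begin

lemma q_M: "(\<lambda>\<omega>. q (feat m d \<omega>)) \<in> borel_measurable M"
  using measurable_compose[OF feat_M[OF d]] q by (auto simp: propensity_function_def)

text \<open>The function \<open>q\<close> is tied to a propensity only almost surely under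
  \<open>m'\<close>; since the laws of the feature agree, its bounds hold almost surely under
  \<open>m\<close> as well.\<close>

lemma propensity_function_range: "AE \<omega> in M. 0 \<le> q (feat m d \<omega>) \<and> q (feat m d \<omega>) \<le> 1"
proof -
  have [measurable]: "q \<in> borel_measurable X"
    and "AE \<omega> in pspace m'. propensity X m' d \<omega> = q (feat m' d \<omega>)"
    using q by (auto simp: propensity_function_def)
  from this(2) other.propensity_range[OF d]
  have "AE \<omega> in pspace m'. 0 \<le> q (feat m' d \<omega>) \<and> q (feat m' d \<omega>) \<le> 1"
    by eventually_elim simp
  then show ?thesis
    by (subst (asm) AE_transfer) measurable
qed

lemma propensity_function_pos:
  assumes "AE \<omega> in pspace m'. 0 < propensity X m' d \<omega>"
  shows "AE \<omega> in M. 0 < q (feat m d \<omega>)"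
proof -
  have [measurable]: "q \<in> borel_measurable X"
    and "AE \<omega> in pspace m'. propensity X m' d \<omega> = q (feat m' d \<omega>)"
    using q by (auto simp: propensity_function_def)
  from this(2) assms have "AE \<omega> in pspace m'. 0 < q (feat m' d \<omega>)"
    by eventually_elim simp
  then show ?thesis
    by (subst (asm) AE_transfer) measurable
qed

text \<open>One statement covers the three second moments: with arguments propensity, conditional
  mean and error called \<open>a\<close>, \<open>b\<close>, \<open>c\<close>, the weight
  \<open>W\<close> is \<open>c\<^sup>2 / a\<close> for IPS, \<open>(c - b)\<^sup>2 / a\<close> for
  DR and \<open>a * (c - b)\<^sup>2\<close> for EIB.\<close>

lemma weighted_transfer:
  fixes W :: "real \<Rightarrow> real \<Rightarrow> real \<Rightarrow> real"
  assumes W: "(\<lambda>t. W (fst t) (fst (snd t)) (snd (snd t))) \<in> borel_measurable (borel \<Otimes>\<^sub>M borel \<Otimes>\<^sub>M borel)"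
  shows "other.expectation (\<lambda>\<omega>. W (propensity X m' d \<omega>) (err_mean X f l m' d \<omega>) (err f l m' d \<omega>))
      = expectation (\<lambda>\<omega>. W (q (feat m d \<omega>)) (err_mean X f l m d \<omega>) (err f l m d \<omega>))" (is ?e)
    and "integrable (pspace m') (\<lambda>\<omega>. W (propensity X m' d \<omega>) (err_mean X f l m' d \<omega>) (err f l m' d \<omega>)) \<longleftrightarrow>
      integrable M (\<lambda>\<omega>. W (q (feat m d \<omega>)) (err_mean X f l m d \<omega>) (err f l m d \<omega>))" (is ?i)
proof -
  have [measurable]: "q \<in> borel_measurable X"
    and pq: "AE \<omega> in pspace m'. propensity X m' d \<omega> = q (feat m' d \<omega>)"
    using q by (auto simp: propensity_function_def)
  note other.feat_M [OF d, measurable] other.err_mean_M [OF d, measurable]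
    other.propensity_M [OF d, measurable] other.err_M [OF d, measurable]
  obtain h where h [measurable]: "h \<in> borel_measurable X"
    and g: "\<And>\<omega>. \<omega> \<in> space M \<Longrightarrow> err_mean X f l m d \<omega> = h (feat m d \<omega>)"
    using err_mean_factor[OF d] by metis
  have "(\<lambda>t. (q (fst t), h (fst t), snd t)) \<in> measurable (X \<Otimes>\<^sub>M borel) (borel \<Otimes>\<^sub>M borel \<Otimes>\<^sub>M borel)"
    by measurable
  from measurable_compose[OF this W]
  have W1: "(\<lambda>t. W (q (fst t)) (h (fst t)) (snd t)) \<in> borel_measurable (X \<Otimes>\<^sub>M borel)"
    by simp
  let ?W' = "\<lambda>\<omega>. W (q (feat m' d \<omega>)) (h (feat m' d \<omega>)) (err f l m' d \<omega>)"
  have W'M: "?W' \<in> borel_measurable (pspace m')"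
    using measurable_compose[OF other.feat_err_M[OF d] W1] by simp
  have "(\<lambda>\<omega>. (propensity X m' d \<omega>, err_mean X f l m' d \<omega>, err f l m' d \<omega>))
      \<in> measurable (pspace m') (borel \<Otimes>\<^sub>M borel \<Otimes>\<^sub>M borel)"
    by measurable
  from measurable_compose[OF this W]
  have W2: "(\<lambda>\<omega>. W (propensity X m' d \<omega>) (err_mean X f l m' d \<omega>) (err f l m' d \<omega>))
      \<in> borel_measurable (pspace m')"
    by simp
  have ae: "AE \<omega> in pspace m'.
      W (propensity X m' d \<omega>) (err_mean X f l m' d \<omega>) (err f l m' d \<omega>) = ?W' \<omega>"
    using pq err_mean_transfer[OF h g, simplified] by eventually_elim simp
  have "other.expectation ?W' =
      expectation (\<lambda>\<omega>. W (q (feat m d \<omega>)) (h (feat m d \<omega>)) (err f l m d \<omega>))"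
    by (rule integral_transfer[OF W1])
  also have "\<dots> = expectation (\<lambda>\<omega>. W (q (feat m d \<omega>)) (err_mean X f l m d \<omega>) (err f l m d \<omega>))"
    by (intro Bochner_Integration.integral_cong refl) (simp add: g)
  finally show ?e
    using integral_cong_AE[OF W2 W'M ae] by simp
  have "integrable (pspace m') ?W' \<longleftrightarrow>
      integrable M (\<lambda>\<omega>. W (q (feat m d \<omega>)) (h (feat m d \<omega>)) (err f l m d \<omega>))"
    by (rule integrable_transfer[OF W1])
  also have "\<dots> \<longleftrightarrow>
      integrable M (\<lambda>\<omega>. W (q (feat m d \<omega>)) (err_mean X f l m d \<omega>) (err f l m d \<omega>))"
    by (intro Bochner_Integration.integrable_cong refl) (simp add: g)
  finally show ?i
    using integrable_cong_AE[OF W2 W'M ae] by simp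
qed

end

end


text \<open>The variance in \<open>m'\<close> becomes a sum of integrals over the measure of
  \<open>m\<close>, into which \<open>m'\<close> enters only through \<open>q\<close>. A sequence of
  models thereby turns into a sequence of integrands on one space, as the convergence theorems
  require.\<close>

lemma IPS_fixed_law:
  assumes "accurate_imputation D X f l m'" "accurate_propensity D X m'" "ips_square_integrable D f l m'"
    and q: "\<And>d. d \<in> D \<Longrightarrow> propensity_function X m' d q"
  defines "t \<equiv> \<lambda>d. expectation (\<lambda>\<omega>. (err f l m d \<omega>)\<^sup>2 / q (feat m d \<omega>)) - (expectation (err f l m d))\<^sup>2"
  shows "Var m' (L_IPS D f l m') = (\<Sum>d\<in>D. t d) / (real (card D))\<^sup>2"
    and "\<And>d. d \<in> D \<Longrightarrow> 0 \<le> t d"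
    and "\<And>d. d \<in> D \<Longrightarrow> integrable M (\<lambda>\<omega>. (err f l m d \<omega>)\<^sup>2 / q (feat m d \<omega>))"
proof -
  have W: "(\<lambda>t. (snd (snd t))\<^sup>2 / fst t :: real) \<in> borel_measurable (borel \<Otimes>\<^sub>M (borel :: real measure) \<Otimes>\<^sub>M borel)"
    by measurable
  note o = assms(1-3)
  have t: "other.expectation (\<lambda>\<omega>. (other.IPS d \<omega>)\<^sup>2) - (other.expectation (err f l m' d))\<^sup>2 = t d"
    if d: "d \<in> D" for d
    using weighted_transfer(1)[OF d q[OF d], of "\<lambda>a _ c. c\<^sup>2 / a", OF W]
    by (simp add: other.pair_second_moments(1)[OF o d] mean_transfer[OF d] t_def)
  show "Var m' (L_IPS D f l m') = (\<Sum>d\<in>D. t d) / (real (card D))\<^sup>2"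
    unfolding other.IPS_Var[OF o] using t by simp
  show "0 \<le> t d" if d: "d \<in> D" for d
    using other.IPS_term_nonneg[OF o d] t[OF d] by simp
  show "integrable M (\<lambda>\<omega>. (err f l m d \<omega>)\<^sup>2 / q (feat m d \<omega>))" if d: "d \<in> D" for d
    using other.pair_second_moments(2)[OF o d]
      weighted_transfer(2)[OF d q[OF d], of "\<lambda>a _ c. c\<^sup>2 / a", OF W] by simp
qed

lemma DR_fixed_law:
  assumes "accurate_imputation D X f l m'" "accurate_propensity D X m'" "ips_square_integrable D f l m'"
    and q: "\<And>d. d \<in> D \<Longrightarrow> propensity_function X m' d q"
  defines "t \<equiv> \<lambda>d. (expectation (\<lambda>\<omega>. (err_mean X f l m d \<omega>)\<^sup>2) - (expectation (err f l m d))\<^sup>2)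
      + expectation (\<lambda>\<omega>. (err f l m d \<omega> - err_mean X f l m d \<omega>)\<^sup>2 / q (feat m d \<omega>))"
  shows "Var m' (L_DR D f l m') = (\<Sum>d\<in>D. t d) / (real (card D))\<^sup>2"
    and "\<And>d. d \<in> D \<Longrightarrow> 0 \<le> t d"
    and "\<And>d. d \<in> D \<Longrightarrow>
      integrable M (\<lambda>\<omega>. (err f l m d \<omega> - err_mean X f l m d \<omega>)\<^sup>2 / q (feat m d \<omega>))"
proof -
  have W: "(\<lambda>t. (snd (snd t) - fst (snd t))\<^sup>2 / fst t :: real)
      \<in> borel_measurable (borel \<Otimes>\<^sub>M borel \<Otimes>\<^sub>M borel)"
    by measurable
  note o = assms(1-3)
  have t: "other.expectation (\<lambda>\<omega>. (other.DR d \<omega>)\<^sup>2) - (other.expectation (err f l m' d))\<^sup>2 = t d"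
    if d: "d \<in> D" for d
    using weighted_transfer(1)[OF d q[OF d], of "\<lambda>a b c. (c - b)\<^sup>2 / a", OF W]
    by (simp add: other.pair_second_moments(3)[OF o d] mean_transfer[OF d]
        err_mean_square_transfer[OF d] t_def)
  show "Var m' (L_DR D f l m') = (\<Sum>d\<in>D. t d) / (real (card D))\<^sup>2"
    unfolding other.DR_Var[OF o] using t by simp
  show "0 \<le> t d" if d: "d \<in> D" for d
    using other.DR_term_nonneg[OF o d] t[OF d] by simp
  show "integrable M (\<lambda>\<omega>. (err f l m d \<omega> - err_mean X f l m d \<omega>)\<^sup>2 / q (feat m d \<omega>))"
    if d: "d \<in> D" for d
    using other.pair_second_moments(4)[OF o d]
      weighted_transfer(2)[OF d q[OF d], of "\<lambda>a b c. (c - b)\<^sup>2 / a", OF W] by simp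
qed

lemma EIB_fixed_law:
  assumes imp: "accurate_imputation D X f l m'"
    and q: "\<And>d. d \<in> D \<Longrightarrow> propensity_function X m' d q"
  shows "Var m' (L_EIB D f l m') = (\<Sum>d\<in>D.
      (expectation (\<lambda>\<omega>. (err_mean X f l m d \<omega>)\<^sup>2) - (expectation (err f l m d))\<^sup>2)
      + expectation (\<lambda>\<omega>. q (feat m d \<omega>) * (err f l m d \<omega> - err_mean X f l m d \<omega>)\<^sup>2))
      / (real (card D))\<^sup>2"
proof -
  have W: "(\<lambda>t. fst t * (snd (snd t) - fst (snd t))\<^sup>2 :: real)
      \<in> borel_measurable (borel \<Otimes>\<^sub>M borel \<Otimes>\<^sub>M borel)"
    by measurable
  have "other.expectation (\<lambda>\<omega>. (other.EIB d \<omega>)\<^sup>2) - (other.expectation (err f l m' d))\<^sup>2 =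
      (expectation (\<lambda>\<omega>. (err_mean X f l m d \<omega>)\<^sup>2) - (expectation (err f l m d))\<^sup>2)
      + expectation (\<lambda>\<omega>. q (feat m d \<omega>) * (err f l m d \<omega> - err_mean X f l m d \<omega>)\<^sup>2)"
    if d: "d \<in> D" for d
    using weighted_transfer(1)[OF d q[OF d], of "\<lambda>a b c. a * (c - b)\<^sup>2", OF W]
    by (simp add: other.EIB_second_moment[OF d] mean_transfer[OF d] err_mean_square_transfer[OF d])
  then show ?thesis
    unfolding other.EIB_Var[OF imp] by simp
qed

text \<open>Dropping the nonnegative propensity part leaves quantities determined by the law of
  feature and error. The bound thus needs no \<open>q\<close> and holds for every
  propensity.\<close>

lemma EIB_ge:
  assumes imp: "accurate_imputation D X f l m'"
  shows "(\<Sum>d\<in>D. expectation (\<lambda>\<omega>. (err_mean X f l m d \<omega>)\<^sup>2) - (expectation (err f l m d))\<^sup>2)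
      / (real (card D))\<^sup>2 \<le> Var m' (L_EIB D f l m')"
  unfolding other.EIB_Var[OF imp]
proof (intro divide_right_mono sum_mono)
  fix d assume d: "d \<in> D"
  have "0 \<le> other.expectation
      (\<lambda>\<omega>. propensity X m' d \<omega> * (err f l m' d \<omega> - err_mean X f l m' d \<omega>)\<^sup>2)"
    by (rule integral_nonneg_AE)
       (use other.propensity_range[OF d] in \<open>eventually_elim, simp\<close>)
  then show "expectation (\<lambda>\<omega>. (err_mean X f l m d \<omega>)\<^sup>2) - (expectation (err f l m d))\<^sup>2
      \<le> other.expectation (\<lambda>\<omega>. (other.EIB d \<omega>)\<^sup>2) - (other.expectation (err f l m' d))\<^sup>2"
    by (simp add: other.EIB_second_moment[OF d] mean_transfer[OF d] err_mean_square_transfer[OF d])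
qed simp

end

section \<open>The minimal EIB variance and the limits for vanishing propensity\<close>

context rec_setting
begin

text \<open>Since \<open>g\<close> has the same mean as the error, each summand is the variance of
  the conditional mean \<open>g\<close>: what is left of the EIB variance when every error is
  imputed.\<close>

definition EIB_floor :: real where
  "EIB_floor = (\<Sum>d\<in>D. expectation (\<lambda>\<omega>. (err_mean X f l m d \<omega>)\<^sup>2) - (expectation (err f l m d))\<^sup>2)
      / (real (card D))\<^sup>2"

lemma matched_settingsI:
  assumes "rec_setting m' D X f l" "same_feat_err_law D X f l m m'"
  shows "matched_settings m m' D X f l"
  using assms rec_setting_axioms by (simp add: matched_settings_def matched_settings_axioms_def)

lemma EIB_floor_le: "v \<in> EIB_variances D X f l m \<Longrightarrow> EIB_floor \<le> v"
  unfolding EIB_variances_def EIB_floor_def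
  using matched_settings.EIB_ge[OF matched_settingsI] by blast

text \<open>The lower bound is a genuine minimum: removing all exposure changes neither the
  conditional mean of the error nor the accuracy of the imputation, and it annihilates the
  propensity part.\<close>

lemma EIB_floor_attained:
  assumes imp: "accurate_imputation D X f l m"
  shows "EIB_floor \<in> EIB_variances D X f l m"
proof -
  interpret u: rec_setting unexposed D X f l
    by (rule rec_setting_unexposed)
  have imp': "accurate_imputation D X f l unexposed"
    using imp unfolding accurate_imputation_def pspace_unexposed by (simp add: err_mean_unexposed)
  have same: "same_feat_err_law D X f l m unexposed"
    by (simp add: same_feat_err_law_def err_unexposed)
  have "u.expectation (\<lambda>\<omega>. (u.EIB d \<omega>)\<^sup>2) = expectation (\<lambda>\<omega>. (err_mean X f l m d \<omega>)\<^sup>2)"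
    if d: "d \<in> D" for d
  proof -
    have "u.expectation (\<lambda>\<omega>. propensity X unexposed d \<omega> *
        (err f l unexposed d \<omega> - err_mean X f l unexposed d \<omega>)\<^sup>2) = 0"
      unfolding pspace_unexposed
      by (rule integral_eq_zero_AE) (use propensity_unexposed[OF d] in \<open>eventually_elim, simp\<close>)
    then show ?thesis
      unfolding u.EIB_second_moment[OF d] by (simp add: err_mean_unexposed)
  qed
  then have "Var unexposed (L_EIB D f l unexposed) = EIB_floor"
    unfolding u.EIB_Var[OF imp'] EIB_floor_def by (simp add: err_unexposed)
  then show ?thesis
    unfolding EIB_variances_def
    by (intro CollectI exI[of _ unexposed] conjI imp' same rec_setting_unexposed) simp
qed

context
  fixes ms :: "nat \<Rightarrow> ('a, 'x, 'd) rec_model" and q :: "nat \<Rightarrow> 'x \<Rightarrow> real"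
  assumes setting: "\<And>n. rec_setting (ms n) D X f l"
    and acc_prop: "\<And>n. accurate_propensity D X (ms n)"
    and acc_imp: "\<And>n. accurate_imputation D X f l (ms n)"
    and ips_sq: "\<And>n. ips_square_integrable D f l (ms n)"
    and law: "\<And>n. same_feat_err_law D X f l m (ms n)"
    and q: "\<And>n d. d \<in> D \<Longrightarrow> propensity_function X (ms n) d (q n)"
    and q_0: "\<And>d. d \<in> D \<Longrightarrow> AE \<xi> in distr M X (feat m d). (\<lambda>n. q n \<xi>) \<longlonglongrightarrow> 0"
begin

lemma matched: "matched_settings m (ms n) D X f l"
  by (rule matched_settingsI[OF setting law])

lemma limit_facts:
  assumes d: "d \<in> D"
  shows "(\<lambda>\<omega>. q n (feat m d \<omega>)) \<in> borel_measurable M"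
    and "AE \<omega> in M. 0 \<le> q n (feat m d \<omega>) \<and> q n (feat m d \<omega>) \<le> 1"
    and "AE \<omega> in M. 0 < q n (feat m d \<omega>)"
    and "AE \<omega> in M. (\<lambda>n. q n (feat m d \<omega>)) \<longlonglongrightarrow> 0"
proof -
  show "(\<lambda>\<omega>. q n (feat m d \<omega>)) \<in> borel_measurable M"
    by (rule matched_settings.q_M[OF matched d q[OF d]])
  show "AE \<omega> in M. 0 \<le> q n (feat m d \<omega>) \<and> q n (feat m d \<omega>) \<le> 1"
    by (rule matched_settings.propensity_function_range[OF matched d q[OF d]])
  show "AE \<omega> in M. 0 < q n (feat m d \<omega>)"
    by (rule matched_settings.propensity_function_pos[OF matched d q[OF d]
          rec_setting.propensity_pos[OF setting acc_imp acc_prop ips_sq d]])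
  show "AE \<omega> in M. (\<lambda>n. q n (feat m d \<omega>)) \<longlonglongrightarrow> 0"
    by (rule AE_distrD[OF feat_M[OF d] q_0[OF d]])
qed

text \<open>A single pair with a nonzero error suffices: its contribution diverges, the constant
  squared mean notwithstanding, and the contributions of the other pairs are nonnegative.\<close>

lemma IPS_diverges:
  assumes d: "d \<in> D" and nz: "\<not> (AE \<omega> in M. err f l m d \<omega> = 0)"
  shows "filterlim (\<lambda>n. Var (ms n) (L_IPS D f l (ms n))) at_top sequentially"
proof -
  note I = matched_settings.IPS_fixed_law[OF matched acc_imp acc_prop ips_sq q]
  have V: "Var (ms n) (L_IPS D f l (ms n)) = (\<Sum>d\<in>D. expectation (\<lambda>\<omega>. (err f l m d \<omega>)\<^sup>2 / q n (feat m d \<omega>)) - (expectation (err f l m d))\<^sup>2)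
      / (real (card D))\<^sup>2" for n
    by (rule I(1))
  have "filterlim (\<lambda>n. expectation (\<lambda>\<omega>. (err f l m d \<omega>)\<^sup>2 / q n (feat m d \<omega>))) at_top sequentially"
    by (rule integral_quotient_blowup) (use d nz err_M[OF d] I(3) limit_facts in auto)
  then have "filterlim (\<lambda>n. - (expectation (err f l m d))\<^sup>2
      + expectation (\<lambda>\<omega>. (err f l m d \<omega>)\<^sup>2 / q n (feat m d \<omega>))) at_top sequentially"
    by (rule filterlim_tendsto_add_at_top[OF tendsto_const])
  then have t: "filterlim (\<lambda>n. expectation (\<lambda>\<omega>. (err f l m d \<omega>)\<^sup>2 / q n (feat m d \<omega>))
      - (expectation (err f l m d))\<^sup>2) at_top sequentially"
    by simp
  show ?thesis
    unfolding V by (rule filterlim_sum_at_top[OF finite_pairs d card_square_pos])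
      (rule I(2), assumption+, rule t)
qed

lemma DR_diverges:
  assumes d: "d \<in> D" and nz: "\<not> (AE \<omega> in M. err_var X f l m d \<omega> = 0)"
  shows "filterlim (\<lambda>n. Var (ms n) (L_DR D f l (ms n))) at_top sequentially"
proof -
  note I = matched_settings.DR_fixed_law[OF matched acc_imp acc_prop ips_sq q]
  have V: "Var (ms n) (L_DR D f l (ms n)) = (\<Sum>d\<in>D. (expectation (\<lambda>\<omega>. (err_mean X f l m d \<omega>)\<^sup>2) - (expectation (err f l m d))\<^sup>2)
          + expectation (\<lambda>\<omega>. (err f l m d \<omega> - err_mean X f l m d \<omega>)\<^sup>2 / q n (feat m d \<omega>)))
      / (real (card D))\<^sup>2" for n
    by (rule I(1))
  \<comment> \<open>The blow-up argument needs a residual that is not almost surely 0; a vanishing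
    residual would make the conditional variance vanish.\<close>
  have nz': "\<not> (AE \<omega> in M. (err f l m d \<omega> - err_mean X f l m d \<omega>)\<^sup>2 = 0)"
    using nz residual_zero[OF d] by blast
  have "filterlim (\<lambda>n. expectation (\<lambda>\<omega>. (err f l m d \<omega> - err_mean X f l m d \<omega>)\<^sup>2 / q n (feat m d \<omega>)))
      at_top sequentially"
    by (rule integral_quotient_blowup)
       (use d nz' err_M[OF d] err_mean_M[OF d] I(3) limit_facts in auto)
  then have t: "filterlim (\<lambda>n. (expectation (\<lambda>\<omega>. (err_mean X f l m d \<omega>)\<^sup>2) - (expectation (err f l m d))\<^sup>2)
      + expectation (\<lambda>\<omega>. (err f l m d \<omega> - err_mean X f l m d \<omega>)\<^sup>2 / q n (feat m d \<omega>))) at_top sequentially"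
    by (rule filterlim_tendsto_add_at_top[OF tendsto_const])
  show ?thesis
    unfolding V by (rule filterlim_sum_at_top[OF finite_pairs d card_square_pos])
      (rule I(2), assumption+, rule t)
qed

text \<open>Since \<open>q n\<close> lies between 0 and 1, the squared residual dominates the
  propensity part for all \<open>n\<close>, and its integral tends to 0.\<close>

lemma EIB_tendsto_floor: "(\<lambda>n. Var (ms n) (L_EIB D f l (ms n))) \<longlonglongrightarrow> EIB_floor"
proof -
  let ?r = "\<lambda>d n. expectation (\<lambda>\<omega>. q n (feat m d \<omega>) * (err f l m d \<omega> - err_mean X f l m d \<omega>)\<^sup>2)"
  have V: "Var (ms n) (L_EIB D f l (ms n)) = (\<Sum>d\<in>D. (expectation (\<lambda>\<omega>. (err_mean X f l m d \<omega>)\<^sup>2)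
      - (expectation (err f l m d))\<^sup>2) + ?r d n) / (real (card D))\<^sup>2" for n
    by (rule matched_settings.EIB_fixed_law[OF matched acc_imp]) (rule q)
  have "?r d \<longlonglongrightarrow> 0" if d: "d \<in> D" for d
  proof -
    let ?R = "\<lambda>\<omega>. (err f l m d \<omega> - err_mean X f l m d \<omega>)\<^sup>2"
    note [measurable] = limit_facts(1)[OF d] err_M[OF d] err_mean_M[OF d]
    have "?r d \<longlonglongrightarrow> expectation (\<lambda>_. 0)"
    proof (rule integral_dominated_convergence[where w = ?R])
      show "AE \<omega> in M. (\<lambda>n. q n (feat m d \<omega>) * ?R \<omega>) \<longlonglongrightarrow> 0"
        using limit_facts(4)[OF d] by eventually_elim (rule tendsto_mult_left_zero)
      show "AE \<omega> in M. norm (q n (feat m d \<omega>) * ?R \<omega>) \<le> ?R \<omega>" for n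
        using limit_facts(2)[OF d, of n] by eventually_elim (simp add: abs_mult mult_left_le_one_le)
    qed (use residual_square_integrable[OF d] in auto)
    then show ?thesis
      by simp
  qed
  then have "(\<lambda>n. (\<Sum>d\<in>D. (expectation (\<lambda>\<omega>. (err_mean X f l m d \<omega>)\<^sup>2)
      - (expectation (err f l m d))\<^sup>2) + ?r d n) / (real (card D))\<^sup>2)
      \<longlonglongrightarrow> (\<Sum>d\<in>D. (expectation (\<lambda>\<omega>. (err_mean X f l m d \<omega>)\<^sup>2)
      - (expectation (err f l m d))\<^sup>2) + 0) / (real (card D))\<^sup>2"
    using card_square_pos by (intro tendsto_intros) auto
  then show ?thesis
    unfolding V EIB_floor_def by simp
qed

end

end

text \<open>The converse equality claims need nondegeneracy: if the error vanishes, all three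
  variances are 0 whatever the propensity is. A positive conditional variance handles EIB against DR
  and a nonzero conditional mean handles DR against IPS; for both equalities together a positive
  conditional second moment suffices. Likewise IPS cannot diverge when the error is 0, and the DR
  variance stays constant in the limit when the error is a function of the feature, which explains
  the two nonvanishing conditions on divergence.\<close>

theorem proposition1:
  fixes m :: "('a, 'x, 'u \<times> 'i) rec_model"
    and Users :: "'u set" and Items :: "'i set" and D :: "('u \<times> 'i) set"
    and X :: "'x measure" and f :: "'x \<Rightarrow> real" and l :: "real \<Rightarrow> real \<Rightarrow> real"
  assumes "finite Users" and "finite Items" and "D = Users \<times> Items"
    and "rec_setting m D X f l"
    and "accurate_propensity D X m"
    and "accurate_imputation D X f l m"
    and "ips_square_integrable D f l m"
  shows
    "unbiased D f l m (L_IPS D f l m) \<and>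
     unbiased D f l m (L_EIB D f l m) \<and>
     unbiased D f l m (L_DR D f l m) \<and>
     Var m (L_EIB D f l m) \<le> Var m (L_DR D f l m) \<and>
     Var m (L_DR D f l m) \<le> Var m (L_IPS D f l m) \<and>
     ((\<forall>d\<in>D. AE \<omega> in pspace m. propensity X m d \<omega> = 1) \<longrightarrow>
        Var m (L_EIB D f l m) = Var m (L_DR D f l m) \<and>
        Var m (L_DR D f l m) = Var m (L_IPS D f l m)) \<and>
     ((\<forall>d\<in>D. AE \<omega> in pspace m. err_var X f l m d \<omega> > 0) \<longrightarrow>
        (Var m (L_EIB D f l m) = Var m (L_DR D f l m) \<longleftrightarrow>
         (\<forall>d\<in>D. AE \<omega> in pspace m. propensity X m d \<omega> = 1))) \<and>
     ((\<forall>d\<in>D. AE \<omega> in pspace m. err_mean X f l m d \<omega> \<noteq> 0) \<longrightarrow>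
        (Var m (L_DR D f l m) = Var m (L_IPS D f l m) \<longleftrightarrow>
         (\<forall>d\<in>D. AE \<omega> in pspace m. propensity X m d \<omega> = 1))) \<and>
     ((\<forall>d\<in>D. AE \<omega> in pspace m. cond_exp_feat X m d (\<lambda>\<omega>. (err f l m d \<omega>)\<^sup>2) \<omega> > 0) \<longrightarrow>
        (Var m (L_EIB D f l m) = Var m (L_DR D f l m) \<and>
         Var m (L_DR D f l m) = Var m (L_IPS D f l m) \<longleftrightarrow>
         (\<forall>d\<in>D. AE \<omega> in pspace m. propensity X m d \<omega> = 1))) \<and>
     (\<forall>(ms :: nat \<Rightarrow> ('a, 'x, 'u \<times> 'i) rec_model) (q :: nat \<Rightarrow> 'x \<Rightarrow> real).
        (\<forall>n. rec_setting (ms n) D X f l \<and>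
             accurate_propensity D X (ms n) \<and>
             accurate_imputation D X f l (ms n) \<and>
             ips_square_integrable D f l (ms n) \<and>
             same_feat_err_law D X f l m (ms n) \<and>
             (\<forall>d\<in>D. propensity_function X (ms n) d (q n))) \<and>
        (\<forall>d\<in>D. AE \<xi> in distr (pspace m) X (feat m d). (\<lambda>n. q n \<xi>) \<longlonglongrightarrow> 0)
        \<longrightarrow>
        ((\<exists>d\<in>D. \<not> (AE \<omega> in pspace m. err f l m d \<omega> = 0)) \<longrightarrow>
           filterlim (\<lambda>n. Var (ms n) (L_IPS D f l (ms n))) at_top sequentially) \<and>
        ((\<exists>d\<in>D. \<not> (AE \<omega> in pspace m. err_var X f l m d \<omega> = 0)) \<longrightarrow>
           filterlim (\<lambda>n. Var (ms n) (L_DR D f l (ms n))) at_top sequentially) \<and>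
        (\<exists>v \<in> EIB_variances D X f l m.
           (\<forall>v' \<in> EIB_variances D X f l m. v \<le> v') \<and>
           (\<lambda>n. Var (ms n) (L_EIB D f l (ms n))) \<longlonglongrightarrow> v))"
proof -
  interpret rec_setting m D X f l
    by fact
  note acc = \<open>accurate_imputation D X f l m\<close> \<open>accurate_propensity D X m\<close> \<open>ips_square_integrable D f l m\<close>
  note unb = IPS_unbiased[OF acc] EIB_unbiased[OF acc(1)] DR_unbiased[OF acc]
  note le = Var_EIB_le_DR[OF acc] Var_DR_le_IPS[OF acc]
  note eq = Var_EIB_eq_DR_iff[OF acc] Var_DR_eq_IPS_iff[OF acc]
  let ?one = "\<forall>d\<in>D. AE \<omega> in pspace m. propensity X m d \<omega> = 1"
  have eq1: "Var m (L_EIB D f l m) = Var m (L_DR D f l m) \<and>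
      Var m (L_DR D f l m) = Var m (L_IPS D f l m)" if one: ?one
  proof
    show "Var m (L_EIB D f l m) = Var m (L_DR D f l m)"
      unfolding eq(1)
    proof
      fix d assume "d \<in> D"
      with one have "AE \<omega> in M. propensity X m d \<omega> = 1"
        by simp
      then show "AE \<omega> in M. propensity X m d \<omega> = 1 \<or> err_var X f l m d \<omega> = 0"
        by eventually_elim simp
    qed
    show "Var m (L_DR D f l m) = Var m (L_IPS D f l m)"
      unfolding eq(2)
    proof
      fix d assume "d \<in> D"
      with one have "AE \<omega> in M. propensity X m d \<omega> = 1"
        by simp
      then show "AE \<omega> in M. propensity X m d \<omega> = 1 \<or> err_mean X f l m d \<omega> = 0"
        by eventually_elim simp
    qed
  qed
  have eq2: "?one" if pos: "\<forall>d\<in>D. AE \<omega> in pspace m. err_var X f l m d \<omega> > 0"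
    and e: "Var m (L_EIB D f l m) = Var m (L_DR D f l m)"
  proof
    fix d assume d: "d \<in> D"
    from bspec[OF pos d] bspec[OF e[unfolded eq(1)] d]
    show "AE \<omega> in M. propensity X m d \<omega> = 1"
      by eventually_elim simp
  qed
  have eq3: "?one" if nz: "\<forall>d\<in>D. AE \<omega> in pspace m. err_mean X f l m d \<omega> \<noteq> 0"
    and e: "Var m (L_DR D f l m) = Var m (L_IPS D f l m)"
  proof
    fix d assume d: "d \<in> D"
    from bspec[OF nz d] bspec[OF e[unfolded eq(2)] d]
    show "AE \<omega> in M. propensity X m d \<omega> = 1"
      by eventually_elim simp
  qed
  have eq4: "?one"
    if pos: "\<forall>d\<in>D. AE \<omega> in pspace m. cond_exp_feat X m d (\<lambda>\<omega>. (err f l m d \<omega>)\<^sup>2) \<omega> > 0"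
      and e: "Var m (L_EIB D f l m) = Var m (L_DR D f l m)" "Var m (L_DR D f l m) = Var m (L_IPS D f l m)"
  proof
    fix d assume d: "d \<in> D"
    \<comment> \<open>Where the propensity differs from 1, the two criteria make both conditional
      variance and conditional mean 0, against the positive conditional second moment, which is the
      variance plus the squared mean.\<close>
    from bspec[OF pos d] bspec[OF e(1)[unfolded eq(1)] d] bspec[OF e(2)[unfolded eq(2)] d]
      second_moment_split[OF d]
    show "AE \<omega> in M. propensity X m d \<omega> = 1"
      by eventually_elim auto
  qed
  have limits: "((\<exists>d\<in>D. \<not> (AE \<omega> in pspace m. err f l m d \<omega> = 0)) \<longrightarrow>
           filterlim (\<lambda>n. Var (ms n) (L_IPS D f l (ms n))) at_top sequentially) \<and>
        ((\<exists>d\<in>D. \<not> (AE \<omega> in pspace m. err_var X f l m d \<omega> = 0)) \<longrightarrow>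
           filterlim (\<lambda>n. Var (ms n) (L_DR D f l (ms n))) at_top sequentially) \<and>
        (\<exists>v \<in> EIB_variances D X f l m.
           (\<forall>v' \<in> EIB_variances D X f l m. v \<le> v') \<and>
           (\<lambda>n. Var (ms n) (L_EIB D f l (ms n))) \<longlonglongrightarrow> v)"
    if "\<forall>n. rec_setting (ms n) D X f l \<and>
             accurate_propensity D X (ms n) \<and>
             accurate_imputation D X f l (ms n) \<and>
             ips_square_integrable D f l (ms n) \<and>
             same_feat_err_law D X f l m (ms n) \<and>
             (\<forall>d\<in>D. propensity_function X (ms n) d (q n))"
      and "\<forall>d\<in>D. AE \<xi> in distr (pspace m) X (feat m d). (\<lambda>n. q n \<xi>) \<longlonglongrightarrow> 0"
    for ms :: "nat \<Rightarrow> ('a, 'x, 'u \<times> 'i) rec_model" and q :: "nat \<Rightarrow> 'x \<Rightarrow> real"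
  proof -
    have h: "\<And>n. rec_setting (ms n) D X f l" "\<And>n. accurate_propensity D X (ms n)"
      "\<And>n. accurate_imputation D X f l (ms n)" "\<And>n. ips_square_integrable D f l (ms n)"
      "\<And>n. same_feat_err_law D X f l m (ms n)"
      "\<And>n d. d \<in> D \<Longrightarrow> propensity_function X (ms n) d (q n)"
      "\<And>d. d \<in> D \<Longrightarrow> AE \<xi> in distr (pspace m) X (feat m d). (\<lambda>n. q n \<xi>) \<longlonglongrightarrow> 0"
      using that by blast+
    show ?thesis
    proof (intro conjI impI bexI ballI)
      show "filterlim (\<lambda>n. Var (ms n) (L_IPS D f l (ms n))) at_top sequentially"
        if ex: "\<exists>d\<in>D. \<not> (AE \<omega> in pspace m. err f l m d \<omega> = 0)"
      proof -
        from ex obtain d where "d \<in> D" "\<not> (AE \<omega> in pspace m. err f l m d \<omega> = 0)" ..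
        from IPS_diverges[OF h this] show ?thesis .
      qed
      show "filterlim (\<lambda>n. Var (ms n) (L_DR D f l (ms n))) at_top sequentially"
        if ex: "\<exists>d\<in>D. \<not> (AE \<omega> in pspace m. err_var X f l m d \<omega> = 0)"
      proof -
        from ex obtain d where "d \<in> D" "\<not> (AE \<omega> in pspace m. err_var X f l m d \<omega> = 0)" ..
        from DR_diverges[OF h this] show ?thesis .
      qed
      show "(\<lambda>n. Var (ms n) (L_EIB D f l (ms n))) \<longlonglongrightarrow> EIB_floor"
        by (rule EIB_tendsto_floor[OF h])
      show "EIB_floor \<le> v'" if "v' \<in> EIB_variances D X f l m" for v'
        by (rule EIB_floor_le[OF that])
      show "EIB_floor \<in> EIB_variances D X f l m"
        by (rule EIB_floor_attained[OF acc(1)])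
    qed
  qed
  show ?thesis
  proof (intro conjI unb le)
    show "?one \<longrightarrow> Var m (L_EIB D f l m) = Var m (L_DR D f l m) \<and>
        Var m (L_DR D f l m) = Var m (L_IPS D f l m)"
      by (intro impI eq1)
    show "(\<forall>d\<in>D. AE \<omega> in pspace m. err_var X f l m d \<omega> > 0) \<longrightarrow>
        (Var m (L_EIB D f l m) = Var m (L_DR D f l m) \<longleftrightarrow> ?one)"
      by (intro impI iffI) (rule eq2, assumption+, rule eq1[THEN conjunct1])
    show "(\<forall>d\<in>D. AE \<omega> in pspace m. err_mean X f l m d \<omega> \<noteq> 0) \<longrightarrow>
        (Var m (L_DR D f l m) = Var m (L_IPS D f l m) \<longleftrightarrow> ?one)"
      by (intro impI iffI) (rule eq3, assumption+, rule eq1[THEN conjunct2])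
    show "(\<forall>d\<in>D. AE \<omega> in pspace m. cond_exp_feat X m d (\<lambda>\<omega>. (err f l m d \<omega>)\<^sup>2) \<omega> > 0) \<longrightarrow>
        (Var m (L_EIB D f l m) = Var m (L_DR D f l m) \<and>
         Var m (L_DR D f l m) = Var m (L_IPS D f l m) \<longleftrightarrow> ?one)"
      by (intro impI iffI) (elim conjE, rule eq4, assumption+, rule eq1)
  qed (intro allI impI, elim conjE, rule limits)
qed

end
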